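(* Let $\ell\ge 4$ and $n\ge 10\ell$ be integers, and let $C_\ell$ be the cycle on $\ell$ vertices. Then $$n+\frac{n}{6\ell}\ \le\ \operatorname{rwsat}(n,C_\ell)\ \le\ \frac{n-4\ell}{\ell-1}\,\ell+\binom{6\ell}{2}.$$
   Context: All graphs are finite and simple; $\bar F$ is the complement of $F$. Colors are taken from an infinite set. An edge-colored graph is rainbow if all its edges receive distinct colors. For a fixed graph $H$, an edge-colored graph $F$ is weakly $H$-rainbow saturated if there is an ordering $e_1,\dots,e_m$ of $E(\bar F)$, $m=|E(\bar F)|$, such that for every injective coloring $c$ of $E(\bar F)$ (distinct edges of $\bar F$ get distinct colors, but these may coincide with colors used on $E(F)$) and every $1\le i\le m$, the edge-colored graph $F+\{e_1,\dots,e_i\}$ contains a rainbow copy of $H$ containing $e_i$. The weak rainbow saturation number $\operatorname{rwsat}(n,H)$ is the minimum number of edges of a weakly $H$-rainbow saturated (edge-colored) graph on $n$ vertices. *)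

theory Defs
  imports Complex_Main "HOL-Library.Ramsey"
begin

text \<open>A graph is a pair of a vertex set and an edge set; edges are two-element vertex sets.\<close>

type_synonym 'a ugraph = "'a set \<times> 'a set set"

abbreviation verts :: "'a ugraph \<Rightarrow> 'a set" where "verts \<equiv> fst"
abbreviation edges :: "'a ugraph \<Rightarrow> 'a set set" where "edges \<equiv> snd"

definition simple_graph :: "'a ugraph \<Rightarrow> bool" where
  "simple_graph G \<longleftrightarrow> finite (verts G) \<and> edges G \<subseteq> [verts G]\<^bsup>2\<^esup>"

definition complement_edges :: "'a ugraph \<Rightarrow> 'a set set" where
  "complement_edges G = [verts G]\<^bsup>2\<^esup> - edges G"

definition add_edges :: "'a ugraph \<Rightarrow> 'a set set \<Rightarrow> 'a ugraph" where
  "add_edges G D = (verts G, edges G \<union> D)"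

definition cycle_graph :: "nat \<Rightarrow> nat ugraph" where
  "cycle_graph l = ({..<l}, (\<lambda>i. {i, (i + 1) mod l}) ` {..<l})"

text \<open>A copy of \<open>H\<close> in \<open>G\<close> is the image of \<open>H\<close> under an injective vertex map \<open>\<phi>\<close> that sends
  edges to edges; copies need not be induced.\<close>

definition rainbow_copy_containing ::
  "'b ugraph \<Rightarrow> 'a ugraph \<Rightarrow> ('a set \<Rightarrow> 'c) \<Rightarrow> 'a set \<Rightarrow> bool" where
  "rainbow_copy_containing H G col e \<longleftrightarrow>
     (\<exists>\<phi>. inj_on \<phi> (verts H) \<and> \<phi> ` verts H \<subseteq> verts G \<and>
          (\<lambda>d. \<phi> ` d) ` edges H \<subseteq> edges G \<and>
          inj_on col ((\<lambda>d. \<phi> ` d) ` edges H) \<and>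
          e \<in> (\<lambda>d. \<phi> ` d) ` edges H)"

text \<open>\<open>K\<close> is the set of available colors. The edge-colored graph is \<open>F\<close> together with \<open>col\<close>, of
  which only the values on \<open>edges F\<close> matter; \<open>col\<close> need not be proper. The ordering \<open>es\<close> is
  chosen before the coloring \<open>c\<close> of the complement.\<close>

definition weakly_rainbow_saturated ::
  "'c set \<Rightarrow> 'b ugraph \<Rightarrow> 'a ugraph \<Rightarrow> ('a set \<Rightarrow> 'c) \<Rightarrow> bool" where
  "weakly_rainbow_saturated K H F col \<longleftrightarrow>
     (\<exists>es. distinct es \<and> set es = complement_edges F \<and>
        (\<forall>c. inj_on c (complement_edges F) \<and> c ` complement_edges F \<subseteq> K \<longrightarrow>
           (\<forall>i < length es.
              rainbow_copy_containing H
                (add_edges F (set (take (Suc i) es)))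
                (\<lambda>e. if e \<in> edges F then col e else c e)
                (es ! i))))"

text \<open>The set of admissible \<open>m\<close> is nonempty whenever \<open>K\<close> is, since complete graphs are vacuously
  saturated; so the least element is attained.\<close>

definition rwsat :: "'c set \<Rightarrow> nat \<Rightarrow> 'b ugraph \<Rightarrow> nat" where
  "rwsat K n H =
     (LEAST m. \<exists>(F :: nat ugraph) col.
        simple_graph F \<and> verts F = {..<n} \<and> col ` edges F \<subseteq> K \<and>
        weakly_rainbow_saturated K H F col \<and> card (edges F) = m)"

end

(* Lower bound. Coloring a new edge with the color of an edge g of F forces its cycle to avoid g.
   Hence F has minimum degree 2, no missing edge across a cut, and every vertex is within distance
   l - 1 of a vertex of degree at least 3: otherwise, let xy be the first new edge touching the ball
   of radius l - 1 around a far vertex; it closes two cycles of length l through different edges of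
   F, and since all degrees in the ball are 2 these paths stay in it and form a component with at
   most 2l - 2 vertices. Growing balls around the vertices of degree at least 3, each layer is at
   most as large as the sum of their degrees, which bounds n by 6l(|E| - n).

   Upper bound. Take a rainbow graph consisting of a clique A of size 2l, joined completely to a
   large independent set Z, and of ears with l - 1 inner vertices attached to two vertices of A. An
   edge can be added if two edge-disjoint F-paths of length l - 1 join its ends, which fills Z and
   joins the second vertex of each ear to Z. Then each neighbor on the ear is joined to Z, by a cycle
   with one F-edge and otherwise new edges in Z, or by an F-path if that F-edge has the color of the
   edge to be added. Afterwards cycles through Z with at most one F-edge add everything else. *)
theory Submission
  imports Defs
begin

section \<open>Cycles as vertex lists\<close>

text \<open>A cycle is handled as a vertex list: the \<open>pedges\<close> of the list together with
  the closing edge \<open>{hd xs, last xs}\<close>. The closing edge plays the role of the newly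
  added edge.\<close>

definition pedges :: "'a list \<Rightarrow> 'a set set" where
  "pedges xs = {{xs ! i, xs ! Suc i} |i. Suc i < length xs}"

lemma pedgesI: "Suc i < length xs \<Longrightarrow> {xs ! i, xs ! Suc i} \<in> pedges xs"
  by (auto simp: pedges_def)

lemma pedges_simps [simp]:
  "pedges [] = {}" "pedges [x] = {}"
  "pedges (x # y # zs) = insert {x, y} (pedges (y # zs))"
proof -
  show "pedges (x # y # zs) = insert {x, y} (pedges (y # zs))"
  proof (intro equalityI subsetI)
    fix d assume "d \<in> pedges (x # y # zs)"
    then obtain i where i: "Suc i < length (x # y # zs)"
      "d = {(x # y # zs) ! i, (x # y # zs) ! Suc i}"
      by (auto simp: pedges_def)
    then show "d \<in> insert {x, y} (pedges (y # zs))"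
      by (cases i) (auto simp: pedges_def)
  next
    fix d assume "d \<in> insert {x, y} (pedges (y # zs))"
    then consider "d = {x, y}" | i where "Suc i < length (y # zs)" "d = {(y # zs) ! i, (y # zs) ! Suc i}"
      by (auto simp: pedges_def)
    then show "d \<in> pedges (x # y # zs)"
    proof cases
      case 1
      then show ?thesis using pedgesI[of 0 "x # y # zs"] by simp
    next
      case 2
      then show ?thesis using pedgesI[of "Suc i" "x # y # zs"] by simp
    qed
  qed
qed (auto simp: pedges_def)

lemma pedges_rev [simp]: "pedges (rev xs) = pedges xs"
proof -
  have "pedges (rev xs) \<subseteq> pedges xs" for xs :: "'a list"
  proof
    fix d assume "d \<in> pedges (rev xs)"
    then obtain i where i: "Suc i < length xs" "d = {rev xs ! i, rev xs ! Suc i}"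
      by (auto simp: pedges_def)
    then have "d = {xs ! (length xs - Suc (Suc i)), xs ! Suc (length xs - Suc (Suc i))}"
      by (auto simp: rev_nth Suc_diff_Suc)
    then show "d \<in> pedges xs"
      using i pedgesI[of "length xs - Suc (Suc i)" xs] by auto
  qed
  from this[of xs] this[of "rev xs"] show ?thesis by auto
qed

lemma pedges_subset: "d \<in> pedges xs \<Longrightarrow> d \<subseteq> set xs"
  by (auto simp: pedges_def)

text \<open>With at least three distinct entries, the first and the last are not consecutive. Hence
  a closing edge never recurs among the other edges of its cycle.\<close>

lemma ends_notin_pedges:
  assumes "distinct xs" "length xs \<ge> 3"
  shows "{hd xs, last xs} \<notin> pedges xs"
proof
  assume "{hd xs, last xs} \<in> pedges xs"
  then obtain i where i: "Suc i < length xs" "{xs ! 0, xs ! (length xs - 1)} = {xs ! i, xs ! Suc i}"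
    using assms by (auto simp: pedges_def hd_conv_nth last_conv_nth simp flip: length_greater_0_conv)
  have eq: "xs ! j = xs ! k \<longleftrightarrow> j = k" if "j < length xs" "k < length xs" for j k
    using that assms(1) by (simp add: nth_eq_iff_index_eq)
  have "xs ! 0 \<noteq> xs ! Suc i" "xs ! (length xs - 1) \<noteq> xs ! i"
    "xs ! 0 = xs ! i \<longleftrightarrow> i = 0" "xs ! (length xs - 1) = xs ! Suc i \<longleftrightarrow> length xs - 1 = Suc i"
    using assms(2) i(1) by (subst eq; force)+
  then show False
    using i assms(2) by (auto simp: doubleton_eq_iff)
qed

lemma image_cycle_edges:
  assumes "length xs = l" "l \<ge> 2"
  shows "(\<lambda>d. (!) xs ` d) ` edges (cycle_graph l) = insert {hd xs, last xs} (pedges xs)"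
    (is "?L = ?R")
proof -
  have ne: "xs \<noteq> []" using assms by auto
  have "?L = (\<lambda>i. {xs ! i, xs ! (Suc i mod l)}) ` {..<l}"
    by (simp add: cycle_graph_def image_image)
  also have "{..<l} = insert (l - 1) {i. Suc i < l}"
    using assms by auto
  also have "(\<lambda>i. {xs ! i, xs ! (Suc i mod l)}) ` \<dots> =
     insert {xs ! (l - 1), xs ! 0} ((\<lambda>i. {xs ! i, xs ! (Suc i mod l)}) ` {i. Suc i < l})"
    using assms by auto
  also have "(\<lambda>i. {xs ! i, xs ! (Suc i mod l)}) ` {i. Suc i < l} = pedges xs"
    using assms by (auto simp: pedges_def)
  finally show ?thesis using ne assms by (auto simp: hd_conv_nth last_conv_nth insert_commute)
qed

lemma rainbow_cycleI:
  assumes "length xs = l" "l \<ge> 2" "distinct xs" "set xs \<subseteq> verts G"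
    "insert {hd xs, last xs} (pedges xs) \<subseteq> edges G"
    "inj_on f (insert {hd xs, last xs} (pedges xs))"
  shows "rainbow_copy_containing (cycle_graph l) G f {hd xs, last xs}"
  unfolding rainbow_copy_containing_def
proof (intro exI conjI)
  show "inj_on ((!) xs) (verts (cycle_graph l))"
    using assms by (auto simp: cycle_graph_def inj_on_def nth_eq_iff_index_eq)
  show "(!) xs ` verts (cycle_graph l) \<subseteq> verts G"
    using assms by (auto simp: cycle_graph_def)
qed (use assms in \<open>simp_all only: image_cycle_edges, simp_all\<close>)

lemma rainbow_cycleE:
  assumes "rainbow_copy_containing (cycle_graph l) G f e" "l \<ge> 2"
  obtains xs where "length xs = l" "distinct xs" "e = {hd xs, last xs}"
    "pedges xs \<subseteq> edges G" "inj_on f (insert e (pedges xs))"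
proof -
  obtain \<phi> where \<phi>: "inj_on \<phi> {..<l}"
    "(\<lambda>d. \<phi> ` d) ` edges (cycle_graph l) \<subseteq> edges G"
    "inj_on f ((\<lambda>d. \<phi> ` d) ` edges (cycle_graph l))"
    "e \<in> (\<lambda>d. \<phi> ` d) ` edges (cycle_graph l)"
    using assms by (auto simp: rainbow_copy_containing_def cycle_graph_def)
  have im: "\<phi> ` {i, Suc i mod l} \<in> (\<lambda>d. \<phi> ` d) ` edges (cycle_graph l)" if "i < l" for i
    using that by (simp add: cycle_graph_def image_image)
  obtain i where i: "i < l" "e = {\<phi> i, \<phi> (Suc i mod l)}"
    using \<phi>(4) by (auto simp: cycle_graph_def)
  \<comment> \<open>Rotating by \<open>Suc i\<close> puts the image of \<open>Suc i mod l\<close>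
    first and that of \<open>i\<close> last, so that \<open>e\<close> becomes the closing
    edge.\<close>
  define xs where "xs = map \<phi> (rotate (Suc i) [0..<l])"
  have len: "length xs = l" by (simp add: xs_def)
  have nth: "xs ! k = \<phi> ((Suc i + k) mod l)" if "k < l" for k
    using that by (simp add: xs_def nth_rotate del: rotate_Suc)
  have "distinct xs"
    using \<phi>(1) by (simp add: xs_def distinct_map atLeast0LessThan del: rotate_Suc)
  moreover have "hd xs = \<phi> (Suc i mod l)"
    using nth[of 0] len assms by (subst hd_conv_nth) auto
  moreover have "last xs = \<phi> i"
    using nth[of "l - 1"] len assms i by (subst last_conv_nth) auto
  moreover have p: "pedges xs \<subseteq> (\<lambda>d. \<phi> ` d) ` edges (cycle_graph l)"
  proof
    fix d assume "d \<in> pedges xs"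
    then obtain k where k: "Suc k < l" "d = {xs ! k, xs ! Suc k}"
      by (auto simp: pedges_def len)
    then have "d = \<phi> ` {(Suc i + k) mod l, Suc ((Suc i + k) mod l) mod l}"
      by (simp add: nth mod_Suc_eq)
    then show "d \<in> (\<lambda>d. \<phi> ` d) ` edges (cycle_graph l)"
      using im[of "(Suc i + k) mod l"] k by simp
  qed
  moreover have "inj_on f (insert e (pedges xs))"
    using p \<phi>(3,4) by (meson inj_on_subset insert_subset)
  ultimately show ?thesis
    using that[of xs] len i(2) \<phi>(2) by (auto simp: insert_commute)
qed

lemma ex_inj_on_infinite:
  assumes "finite A" "infinite K"
  obtains f where "inj_on f A" "f ` A \<subseteq> K"
proof -
  obtain h :: "nat \<Rightarrow> 'b" where h: "inj h" "range h \<subseteq> K"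
    using infinite_countable_subset[OF assms(2)] by auto
  obtain g :: "'a \<Rightarrow> nat" where "inj_on g A"
    using finite_imp_inj_to_nat_seg[OF assms(1)] by auto
  with h show ?thesis
    by (intro that[of "h \<circ> g"] comp_inj_on) (auto intro: inj_on_subset)
qed

lemma ex_inj_on_infinite_value:
  assumes "finite A" "infinite K" "a \<in> A" "k \<in> K"
  obtains f where "inj_on f A" "f ` A \<subseteq> K" "f a = k"
proof -
  obtain f where f: "inj_on f (A - {a})" "f ` (A - {a}) \<subseteq> K - {k}"
    using ex_inj_on_infinite[of "A - {a}" "K - {k}"] assms by auto
  have "inj_on (f(a := k)) A" "(f(a := k)) ` A \<subseteq> K"
    using f assms by (auto simp: inj_on_def)
  then show ?thesis by (intro that[of "f(a := k)"]) auto
qed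

lemma doubleton_in_complement:
  "{x, y} \<in> complement_edges F \<longleftrightarrow> x \<in> verts F \<and> y \<in> verts F \<and> x \<noteq> y \<and> {x, y} \<notin> edges F"
  by (auto simp: complement_edges_def)

lemma finite_complement_edges: "simple_graph F \<Longrightarrow> finite (complement_edges F)"
  by (auto simp: simple_graph_def complement_edges_def intro: finite_imp_finite_nsets)

lemma finite_edges: "simple_graph F \<Longrightarrow> finite (edges F)"
  by (auto simp: simple_graph_def intro: finite_subset finite_imp_finite_nsets)

text \<open>The color of the first complement edge \<open>e\<close> with \<open>Q e\<close> can be chosen adversarially to be that of
  any single edge \<open>g\<close> of \<open>F\<close>, which then is unavailable for the cycle closed by \<open>e\<close>.\<close>

lemma saturated_first_edge:
  assumes sat: "weakly_rainbow_saturated K (cycle_graph l) F col"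
    and F: "simple_graph F" and K: "infinite K" "col ` edges F \<subseteq> K" and l: "l \<ge> 3"
    and e0: "e0 \<in> complement_edges F" "Q e0"
  obtains e T where "e \<in> complement_edges F" "Q e" "T \<subseteq> complement_edges F" "\<And>t. t \<in> T \<Longrightarrow> \<not> Q t"
    "\<And>x y g. e = {x, y} \<Longrightarrow>
       \<exists>xs. length xs = l \<and> distinct xs \<and> hd xs = x \<and> last xs = y \<and>
            pedges xs \<subseteq> edges F \<union> T \<and> (g \<in> edges F \<longrightarrow> g \<notin> pedges xs)"
proof -
  obtain es where es: "distinct es" "set es = complement_edges F"
    and sat: "\<And>c i. inj_on c (complement_edges F) \<Longrightarrow> c ` complement_edges F \<subseteq> K \<Longrightarrow> i < length es \<Longrightarrow>
              rainbow_copy_containing (cycle_graph l)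
                (add_edges F (set (take (Suc i) es)))
                (\<lambda>e. if e \<in> edges F then col e else c e)
                (es ! i)"
    using sat unfolding weakly_rainbow_saturated_def by blast
  \<comment> \<open>The ordering is fixed before the coloring, so \<open>i\<close>, and with it
    \<open>e\<close> and the set of earlier edges, does not depend on \<open>g\<close>. The same
    \<open>e\<close> can thus be used later with several choices of \<open>g\<close>.\<close>
  define i where "i = (LEAST i. i < length es \<and> Q (es ! i))"
  have "\<exists>i. i < length es \<and> Q (es ! i)"
    using e0 es(2) by (metis in_set_conv_nth)
  then have i: "i < length es" "Q (es ! i)"
    unfolding i_def using LeastI_ex[of "\<lambda>i. i < length es \<and> Q (es ! i)"] by auto
  have notQ: "\<not> Q t" if t: "t \<in> set (take i es)" for t
  proof -
    obtain j where j: "j < i" "t = es ! j"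
      using t i(1) by (auto simp: in_set_conv_nth)
    then show ?thesis
      using not_less_Least[of j "\<lambda>i. i < length es \<and> Q (es ! i)"] i(1) by (auto simp: i_def)
  qed
  define e where "e = es ! i"
  have eC: "e \<in> complement_edges F"
    using nth_mem[OF i(1)] es(2) by (simp add: e_def)
  have "\<exists>xs. length xs = l \<and> distinct xs \<and> hd xs = x \<and> last xs = y \<and>
            pedges xs \<subseteq> edges F \<union> set (take i es) \<and> (g \<in> edges F \<longrightarrow> g \<notin> pedges xs)"
    if xy: "e = {x, y}" for x y g
  proof -
    \<comment> \<open>If \<open>g\<close> is not an edge of \<open>F\<close>, nothing is forbidden
      and any color will do.\<close>
    obtain k where k: "k \<in> K" "g \<in> edges F \<longrightarrow> k = col g"
    proof (cases "g \<in> edges F")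
      case True
      then show ?thesis using K that[of "col g"] by blast
    next
      case False
      moreover obtain k where "k \<in> K" using K(1) by (metis finite.emptyI equals0I)
      ultimately show ?thesis using that[of k] by blast
    qed
    obtain c where c: "inj_on c (complement_edges F)" "c ` complement_edges F \<subseteq> K" "c e = k"
      using ex_inj_on_infinite_value[OF finite_complement_edges[OF F] K(1) eC k(1)] by blast
    let ?f = "\<lambda>e. if e \<in> edges F then col e else c e"
    obtain xs where xs: "length xs = l" "distinct xs" "e = {hd xs, last xs}"
      "pedges xs \<subseteq> edges F \<union> set (take (Suc i) es)" "inj_on ?f (insert e (pedges xs))"
      using rainbow_cycleE[OF sat[OF c(1,2) i(1)]] l by (auto simp: add_edges_def e_def)
    have "e \<notin> pedges xs"
      using ends_notin_pedges xs l by blast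
    then have "pedges xs \<subseteq> edges F \<union> set (take i es)"
      using xs(4) i(1) by (auto simp: take_Suc_conv_app_nth e_def)
    moreover have "g \<notin> pedges xs" if "g \<in> edges F"
    proof
      assume "g \<in> pedges xs"
      moreover have "?f g = ?f e"
        using that k c(3) eC by (auto simp: complement_edges_def)
      ultimately show False
        using inj_onD[OF xs(5), of g e] \<open>e \<notin> pedges xs\<close> by auto
    qed
    \<comment> \<open>The cycle determines the list only up to reversal, so \<open>rev xs\<close>
      may be the one that runs from \<open>x\<close> to \<open>y\<close>.\<close>
    moreover have "hd xs = x \<and> last xs = y \<or> hd (rev xs) = x \<and> last (rev xs) = y"
      using xs xy l by (auto simp: doubleton_eq_iff hd_rev last_rev)
    moreover have "length (rev xs) = l" "distinct (rev xs)" "pedges (rev xs) = pedges xs"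
      using xs by auto
    ultimately show ?thesis
      using xs(1,2) by metis
  qed
  moreover have "Q e" "set (take i es) \<subseteq> complement_edges F"
    using i(2) es(2) by (auto simp: e_def dest: in_set_takeD)
  ultimately show ?thesis
    using that[of e "set (take i es)"] notQ eC by blast
qed

section \<open>The lower bound\<close>

definition nbrs :: "'a set set \<Rightarrow> 'a \<Rightarrow> 'a set" where
  "nbrs E u = {w. {u, w} \<in> E}"

lemma mem_nbrs [simp]: "w \<in> nbrs E u \<longleftrightarrow> {u, w} \<in> E"
  by (simp add: nbrs_def)

primrec nball :: "'a set set \<Rightarrow> 'a set \<Rightarrow> nat \<Rightarrow> 'a set" where
  "nball E A 0 = A"
| "nball E A (Suc r) = nball E A r \<union> \<Union> (nbrs E ` nball E A r)"

lemma nball_mono: "r \<le> s \<Longrightarrow> u \<in> nball E A r \<Longrightarrow> u \<in> nball E A s"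
  by (induction s rule: dec_induct) auto

lemma nball_step: "u \<in> nball E A r \<Longrightarrow> {u, w} \<in> E \<Longrightarrow> w \<in> nball E A (Suc r)"
  by auto

text \<open>The triangle inequality for distances: the induction moves the last edge of the walk
  from \<open>v\<close> to \<open>w\<close> over to the walk from \<open>A\<close>.\<close>

lemma nball_trans:
  "w \<in> nball E {v} r \<Longrightarrow> w \<in> nball E A s \<Longrightarrow> v \<in> nball E A (r + s)"
proof (induction r arbitrary: w s)
  case (Suc r)
  then consider "w \<in> nball E {v} r" | u where "u \<in> nball E {v} r" "{u, w} \<in> E"
    by auto
  then show ?case
  proof cases
    case 1
    then show ?thesis using Suc nball_mono[of "r + s" "Suc r + s" v E A] by simp
  next
    case 2
    then have "u \<in> nball E A (Suc s)"
      using Suc.prems(2) by (intro nball_step) (auto simp: insert_commute)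
    then show ?thesis using Suc.IH[OF 2(1)] by fastforce
  qed
qed auto

lemma nball_subset:
  assumes "E \<subseteq> [V]\<^bsup>2\<^esup>" "A \<subseteq> V"
  shows "nball E A r \<subseteq> V"
  by (induction r) (use assms in \<open>auto simp: doubleton_in_nsets_2 dest!: subsetD\<close>)

lemma edge_simple:
  assumes "simple_graph F" "{u, w} \<in> edges F"
  shows "u \<in> verts F" "w \<in> verts F" "u \<noteq> w"
proof -
  have "{u, w} \<in> [verts F]\<^bsup>2\<^esup>"
    using assms unfolding simple_graph_def by blast
  then show "u \<in> verts F" "w \<in> verts F" "u \<noteq> w" by auto
qed

lemma finite_nbrs: "simple_graph F \<Longrightarrow> finite (nbrs (edges F) u)"
  by (rule finite_subset[of _ "verts F"]) (auto simp: edge_simple, simp add: simple_graph_def)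

lemma handshake:
  assumes F: "simple_graph F"
  shows "(\<Sum>v\<in>verts F. card (nbrs (edges F) v)) = 2 * card (edges F)"
proof -
  have fin: "finite (verts F)" "finite (edges F)"
    using F finite_edges[OF F] by (simp_all add: simple_graph_def)
  have "card (nbrs (edges F) v) = card {e \<in> edges F. v \<in> e}" for v
  proof (rule bij_betw_same_card[of "\<lambda>w. {v, w}"], unfold bij_betw_def, intro conjI)
    show "inj_on (\<lambda>w. {v, w}) (nbrs (edges F) v)"
      by (auto simp: inj_on_def doubleton_eq_iff)
    show "(\<lambda>w. {v, w}) ` nbrs (edges F) v = {e \<in> edges F. v \<in> e}"
    proof (intro equalityI subsetI)
      fix e assume e: "e \<in> {e \<in> edges F. v \<in> e}"
      then have "card e = 2"
        using F by (auto simp: simple_graph_def nsets_def)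
      then obtain a b where "e = {a, b}" by (meson card_2_iff)
      with e show "e \<in> (\<lambda>w. {v, w}) ` nbrs (edges F) v"
        by (auto simp: insert_commute)
    qed auto
  qed
  moreover have "(\<Sum>v\<in>verts F. card {e \<in> edges F. v \<in> e}) = 2 * card (edges F)"
  proof (rule sum_multicount[OF fin], intro ballI)
    fix e assume "e \<in> edges F"
    then have "e \<subseteq> verts F" "card e = 2"
      using F by (auto simp: simple_graph_def nsets_def)
    then show "card {v \<in> verts F. v \<in> e} = 2"
      by (metis Collect_conj_eq Collect_mem_eq inf.absorb_iff2)
  qed
  ultimately show ?thesis by simp
qed

lemma path_invariant:
  assumes "\<And>d. d \<in> pedges xs \<Longrightarrow> d \<subseteq> W \<or> d \<inter> W = {}" "i < length xs"
  shows "xs ! i \<in> W \<longleftrightarrow> xs ! 0 \<in> W"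
  using assms(2)
proof (induction i)
  case (Suc i)
  then show ?case
    using assms(1)[OF pedgesI[of i xs]] by auto
qed auto

lemma card_2_eq: "card A = 2 \<Longrightarrow> a \<in> A \<Longrightarrow> b \<in> A \<Longrightarrow> a \<noteq> b \<Longrightarrow> A = {a, b}"
  by (auto simp: card_2_iff)

section \<open>Degrees and distances in a saturated graph\<close>

locale saturated =
  fixes K :: "'c set" and l :: nat and F :: "'a ugraph" and col :: "'a set \<Rightarrow> 'c"
  assumes sat: "weakly_rainbow_saturated K (cycle_graph l) F col"
    and simple: "simple_graph F"
    and colors: "infinite K" "col ` edges F \<subseteq> K"
    and l3: "l \<ge> 3"
    and large: "2 * l < card (verts F)"
begin

abbreviation "V \<equiv> verts F"
abbreviation "E \<equiv> edges F"
abbreviation "N \<equiv> nbrs (edges F)"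

lemmas first_edge = saturated_first_edge[OF sat simple colors l3]

lemma finV: "finite V"
  using simple by (simp add: simple_graph_def)

text \<open>The first new edge across the cut would be the only crossing edge so far, but the cycle
  it closes has to cross back.\<close>

lemma no_cut:
  assumes W: "W \<subseteq> V" "W \<noteq> {}" "W \<noteq> V"
  shows "\<exists>u\<in>W. \<exists>w\<in>V - W. {u, w} \<in> E"
proof (rule ccontr)
  assume no: "\<not> (\<exists>u\<in>W. \<exists>w\<in>V - W. {u, w} \<in> E)"
  define Q where "Q e \<longleftrightarrow> (\<exists>u\<in>W. \<exists>w\<in>V - W. e = {u, w})" for e
  obtain u0 w0 where uw: "u0 \<in> W" "w0 \<in> V - W" using W by auto
  then have "{u0, w0} \<in> complement_edges F" "Q {u0, w0}"
    using no W by (auto simp: doubleton_in_complement Q_def)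
  then obtain e T where e: "e \<in> complement_edges F" "Q e" "T \<subseteq> complement_edges F" "\<And>t. t \<in> T \<Longrightarrow> \<not> Q t"
    and p: "\<And>x y g. e = {x, y} \<Longrightarrow>
       \<exists>xs. length xs = l \<and> distinct xs \<and> hd xs = x \<and> last xs = y \<and>
            pedges xs \<subseteq> E \<union> T \<and> (g \<in> E \<longrightarrow> g \<notin> pedges xs)"
    by (rule first_edge) blast
  obtain x y where xy: "e = {x, y}" "x \<in> W" "y \<in> V - W"
    using e(2) Q_def by auto
  obtain xs where xs: "length xs = l" "hd xs = x" "last xs = y" "pedges xs \<subseteq> E \<union> T"
    using p[OF xy(1)] by blast
  have "d \<subseteq> W \<or> d \<inter> W = {}" if "d \<in> pedges xs" for d
  proof -
    have "d \<in> [V]\<^bsup>2\<^esup>"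
      using that xs(4) e(3) simple by (auto simp: simple_graph_def complement_edges_def)
    then obtain a b where ab: "d = {a, b}" "a \<in> V" "b \<in> V"
      by (auto simp: nsets_def card_2_iff)
    moreover have "\<not> Q d"
      using that xs(4) e(4) no by (auto simp: Q_def)
    ultimately show ?thesis
      unfolding Q_def by (auto simp: doubleton_eq_iff)
  qed
  then have "xs ! (l - 1) \<in> W \<longleftrightarrow> xs ! 0 \<in> W"
    using path_invariant[of xs W "l - 1"] xs l3 by auto
  moreover have "xs ! (l - 1) = y" "xs ! 0 = x"
    using xs l3 by (auto simp: hd_conv_nth last_conv_nth simp flip: length_greater_0_conv)
  ultimately show False using xy by auto
qed

lemma ex_complement_edge:
  assumes "v \<in> V" "card (N v) \<le> 2"
  obtains w where "{v, w} \<in> complement_edges F"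
proof -
  have "card (insert v (N v)) \<le> 3"
    using assms(2) card_insert_le_m1[of 3 "N v" v] by simp
  then have "\<not> V \<subseteq> insert v (N v)"
    using large l3 card_mono[of "insert v (N v)" V] finite_nbrs[OF simple, of v] by fastforce
  then obtain w where "w \<in> V" "w \<noteq> v" "w \<notin> N v" by blast
  then show ?thesis
    using that assms by (auto simp: doubleton_in_complement)
qed

text \<open>The cycle through the first new edge at \<open>v\<close> has a second edge at
  \<open>v\<close>, which must belong to \<open>F\<close>. If \<open>F\<close> had only one edge
  there, giving the new edge its color would block it.\<close>

lemma degree_ge_2:
  assumes v: "v \<in> V"
  shows "card (N v) \<ge> 2"
proof (rule ccontr)
  assume small: "\<not> ?thesis"
  then obtain w where "{v, w} \<in> complement_edges F" using ex_complement_edge[OF v] by auto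
  then obtain e T where e: "v \<in> e" "e \<in> complement_edges F" "\<And>t. t \<in> T \<Longrightarrow> v \<notin> t"
    and p: "\<And>x y g. e = {x, y} \<Longrightarrow>
       \<exists>xs. length xs = l \<and> distinct xs \<and> hd xs = x \<and> last xs = y \<and>
            pedges xs \<subseteq> E \<union> T \<and> (g \<in> E \<longrightarrow> g \<notin> pedges xs)"
    by (rule first_edge[of _ "\<lambda>e. v \<in> e"]) (use that in blast)+
  have "card e = 2" using e(2) by (simp add: complement_edges_def nsets_def)
  then obtain y where y: "e = {v, y}" using e(1) by (auto simp: card_2_iff)
  \<comment> \<open>If \<open>v\<close> has no neighbors at all, \<open>a\<close> is
    arbitrary.\<close>
  obtain a where a: "N v \<subseteq> {a}"
    using small finite_nbrs[OF simple, of v] by (cases "N v = {}") (auto simp: not_le less_2_cases_iff card_1_singleton_iff)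
  obtain xs where xs: "length xs = l" "hd xs = v"
    "pedges xs \<subseteq> E \<union> T" "{v, a} \<in> E \<longrightarrow> {v, a} \<notin> pedges xs"
    using p[OF y, of "{v, a}"] by blast
  have 1: "{v, xs ! 1} \<in> pedges xs"
    using pedgesI[of 0 xs] xs l3 by (auto simp: hd_conv_nth simp flip: length_greater_0_conv)
  then have "{v, xs ! 1} \<in> E" using xs(3) e(3) by auto
  then show False using 1 a xs(4) by auto
qed

definition B :: "'a set" where "B = {v \<in> V. card (N v) \<ge> 3}"

text \<open>All edges added before \<open>e\<close> avoid \<open>S\<close>, so a path of the cycle
  uses only edges of \<open>F\<close> at each vertex of \<open>S\<close>. The radius
  \<open>l - 1\<close> is the number of edges of such a path and keeps both paths inside
  \<open>S\<close>, where all degrees are 2. Their joint vertex set is then closed under neighbors,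
  against \<open>no_cut\<close>.\<close>

lemma near_B:
  assumes v: "v \<in> V"
  shows "v \<in> nball E B (l - 1)"
proof (rule ccontr)
  assume far: "\<not> ?thesis"
  let ?b = "nball E {v}"
  define S where "S = ?b (l - 1)"
  have SV: "S \<subseteq> V"
    unfolding S_def using v simple by (intro nball_subset) (auto simp: simple_graph_def)
  have S: "u \<in> S" if "u \<in> ?b r" "r \<le> l - 1" for u r
    using nball_mono that by (auto simp: S_def)
  have deg: "card (N u) = 2" if u: "u \<in> S" for u
  proof -
    have "u \<notin> B"
      using far nball_trans[of u E v "l - 1" B 0] u by (auto simp: S_def)
    then show ?thesis
      using degree_ge_2[of u] SV u by (force simp: B_def)
  qed
  have "v \<in> S" using S[of v 0] by simp
  obtain w where "{v, w} \<in> complement_edges F"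
    using ex_complement_edge[OF v] deg[OF \<open>v \<in> S\<close>] by auto
  then obtain e T where e: "e \<inter> S \<noteq> {}" "e \<in> complement_edges F" "\<And>t. t \<in> T \<Longrightarrow> t \<inter> S = {}"
    and p: "\<And>x y g. e = {x, y} \<Longrightarrow>
       \<exists>xs. length xs = l \<and> distinct xs \<and> hd xs = x \<and> last xs = y \<and>
            pedges xs \<subseteq> E \<union> T \<and> (g \<in> E \<longrightarrow> g \<notin> pedges xs)"
    by (rule first_edge[of _ "\<lambda>e. e \<inter> S \<noteq> {}"]) (use that \<open>v \<in> S\<close> in blast)+
  then obtain x where x: "x \<in> e" "x \<in> S" by auto
  have "card e = 2" using e(2) by (simp add: complement_edges_def nsets_def)
  then obtain y where y: "e = {x, y}" using x(1) by (auto simp: card_2_iff)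
  have nth: "xs ! 0 = x" "xs ! (l - 1) = y" if "length xs = l" "hd xs = x" "last xs = y" for xs
    using that l3 by (auto simp: hd_conv_nth last_conv_nth simp flip: length_greater_0_conv)
  have nbr: "w \<in> N u" if "u \<in> S" "{u, w} \<in> E \<union> T" for u w
    using that e(3) by auto
  have comm: "w \<in> N u \<longleftrightarrow> u \<in> N w" for u w by (simp add: insert_commute)
  have two: "N u = {a, b}" if "u \<in> S" "a \<in> N u" "b \<in> N u" "a \<noteq> b" for u a b
    using card_2_eq[OF deg] that by blast
  \<comment> \<open>Choose \<open>xs\<close> to start from \<open>x\<close> towards \<open>v\<close>; as all degrees in \<open>S\<close> are \<open>2\<close>, it is forced to run to
    \<open>v\<close> and on to the other side, so it never leaves \<open>S\<close>.\<close>
  define d where "d = (LEAST r. x \<in> ?b r)"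
  have xd: "x \<in> ?b d" and dl: "d \<le> l - 1"
    using x(2) unfolding d_def S_def by (auto intro: LeastI Least_le)
  have dl': "d < l" using dl l3 by simp
  have dmin: "x \<notin> ?b r" if "r < d" for r
    using that not_less_Least unfolding d_def by blast
  obtain xs where xs: "length xs = l" "distinct xs" "hd xs = x" "last xs = y"
    "pedges xs \<subseteq> E \<union> T" and xs1: "d \<ge> 1 \<Longrightarrow> xs ! 1 \<in> ?b (d - 1)"
  proof (cases d)
    \<comment> \<open>Here \<open>x = v\<close>, and any path of \<open>l - 1\<close> edges starting
      at the center stays in \<open>S\<close>.\<close>
    case 0
    then show ?thesis using p[OF y] that by force
  next
    case (Suc d')
    then obtain z where z: "z \<in> ?b d'" "x \<in> N z"
      using xd dmin[of d'] by auto
    \<comment> \<open>\<open>z\<close> is the neighbor of \<open>x\<close> nearer to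
      \<open>v\<close>; forbidding the edge from \<open>x\<close> to its other neighbor
      \<open>z'\<close> forces \<open>xs\<close> to start towards \<open>v\<close>.\<close>
    obtain z' where z': "N x = {z, z'}"
      using deg[OF x(2)] z(2) comm by (metis card_2_iff doubleton_eq_iff insertE singletonD)
    have z'E: "{x, z'} \<in> E" using z' unfolding nbrs_def by blast
    obtain xs where xs: "length xs = l" "distinct xs" "hd xs = x" "last xs = y"
      "pedges xs \<subseteq> E \<union> T" "{x, z'} \<in> E \<longrightarrow> {x, z'} \<notin> pedges xs"
      using p[OF y] by blast
    have 1: "{x, xs ! 1} \<in> pedges xs"
      using pedgesI[of 0 xs] xs l3 nth by auto
    then have "xs ! 1 \<in> N x" using nbr x(2) xs(5) by blast
    moreover have "xs ! 1 \<noteq> z'" using 1 xs(6) z'E by metis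
    ultimately have "xs ! 1 = z" using z' by blast
    then show ?thesis using that xs z(1) Suc by simp
  qed
  note x0 = nth[OF xs(1,3,4)]
  have xe: "{xs ! i, xs ! Suc i} \<in> E \<union> T" if "Suc i < l" for i
    using pedgesI[of i xs] that xs(1,5) by auto
  \<comment> \<open>The lower bound on the distance is carried along because it shows that the
    predecessor on the path is not the neighbor nearer to \<open>v\<close>; by degree 2 the next
    vertex is.\<close>
  have toward: "xs ! i \<in> ?b (d - i) \<and> (\<forall>r < d - i. xs ! i \<notin> ?b r)" if "i \<le> d" for i
    using that
  proof (induction i rule: less_induct)
    case (less i)
    have reach: "\<forall>r < d - Suc j. u \<notin> ?b r" if "\<forall>r < d - j. xs ! j \<notin> ?b r" "u \<in> N (xs ! j)" for u j
    proof (intro allI impI notI)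
      fix r assume "r < d - Suc j" "u \<in> ?b r"
      then have "xs ! j \<in> ?b (Suc r)" "Suc r < d - j"
        using that(2) comm by auto
      then show False using that(1) by blast
    qed
    show ?case
    proof (cases i)
      case 0
      then show ?thesis using xd dmin x0 by simp
    next
      case (Suc j)
      have j: "xs ! j \<in> ?b (d - j)" "\<forall>r < d - j. xs ! j \<notin> ?b r"
        using less Suc by auto
      then have "xs ! j \<in> S" using S dl by auto
      then have nx: "xs ! Suc j \<in> N (xs ! j)"
        using nbr[of "xs ! j"] xe[of j] less.prems Suc dl' by simp
      have "xs ! Suc j \<in> ?b (d - Suc j)"
      proof (cases j)
        case 0
        then show ?thesis using xs1 less.prems Suc by simp
      next
        case (Suc j')
        have "d - j = Suc (d - Suc j)" using less.prems \<open>i = Suc j\<close> by simp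
        then obtain z where z: "z \<in> ?b (d - Suc j)" "xs ! j \<in> N z"
          using j by auto
        have j': "\<forall>r < d - j'. xs ! j' \<notin> ?b r"
          using less Suc \<open>i = Suc j\<close> by auto
        then have "z \<noteq> xs ! j'" using z(1) \<open>d - j = _\<close> Suc by auto
        moreover have "xs ! j' \<in> N (xs ! j)"
          using nbr[OF \<open>xs ! j \<in> S\<close>] xe[of j'] Suc less.prems \<open>i = Suc j\<close> dl'
          by (auto simp: insert_commute)
        ultimately have "N (xs ! j) = {xs ! j', z}"
          using two \<open>xs ! j \<in> S\<close> z(2) comm by blast
        moreover have "xs ! Suc j \<noteq> xs ! j'"
          using xs(1,2) Suc less.prems \<open>i = Suc j\<close> dl' by (simp add: nth_eq_iff_index_eq)
        ultimately show ?thesis using nx z(1) by auto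
      qed
      then show ?thesis using reach[OF j(2) nx] Suc by simp
    qed
  qed
  \<comment> \<open>After \<open>d\<close> steps the path is at \<open>v\<close>, and only
    \<open>l - 1 - d\<close> steps are left.\<close>
  have away: "xs ! i \<in> ?b (i - d)" if "d \<le> i" "i < l" for i
    using that
  proof (induction i rule: dec_induct)
    case base
    then show ?case using toward[of d] by simp
  next
    case (step i)
    then have "xs ! i \<in> ?b (i - d)" by simp
    moreover from this have "xs ! i \<in> S" using S step by auto
    then have "{xs ! i, xs ! Suc i} \<in> E" using nbr[OF _ xe[of i]] step by simp
    ultimately show ?case using nball_step step by (fastforce simp: Suc_diff_le)
  qed
  have xsS: "xs ! i \<in> S" if "i < l" for i
    using toward[of i] away[of i] S[of "xs ! i" "d - i"] S[of "xs ! i" "i - d"] that dl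
    by (cases "i \<le> d") auto
  have xN: "xs ! Suc i \<in> N (xs ! i)" if "Suc i < l" for i
    using nbr[OF xsS xe] that by simp
  have yb: "y \<in> ?b (l - 1 - d)"
    using away[of "l - 1"] dl l3 x0 by simp
  \<comment> \<open>Forbidding the last edge of \<open>xs\<close> yields a second path, which leaves \<open>x\<close> and reaches \<open>y\<close> by their other
    edges. Measured from both ends, it too stays in \<open>S\<close>, so the two paths form a component of \<open>F\<close>.\<close>
  define g where "g = {xs ! (l - 2), y}"
  have gE: "g \<in> E"
    using xN[of "l - 2"] l3 x0 by (simp add: g_def numeral_2_eq_2 Suc_diff_Suc)
  obtain ys where ys: "length ys = l" "distinct ys" "hd ys = x" "last ys = y"
      "pedges ys \<subseteq> E \<union> T" "g \<notin> pedges ys"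
    using p[OF y, of g] gE by blast
  note y0 = nth[OF ys(1,3,4)]
  have ye: "{ys ! i, ys ! Suc i} \<in> E \<union> T" if "Suc i < l" for i
    using pedgesI[of i ys] that ys(1,5) by auto
  have ys1: "ys ! i \<in> ?b (d + i)" if "d + i \<le> l - 1" for i
    using that
  proof (induction i)
    case 0
    then show ?case using xd y0 by simp
  next
    case (Suc i)
    then have "ys ! i \<in> ?b (d + i)" by simp
    moreover from this have "ys ! i \<in> S" using S Suc by auto
    then have "{ys ! i, ys ! Suc i} \<in> E" using nbr[OF _ ye[of i]] Suc by simp
    ultimately show ?case using nball_step by fastforce
  qed
  \<comment> \<open>From \<open>x\<close>, at distance \<open>d\<close>, \<open>ys1\<close> controls
    the first \<open>l - 1 - d\<close> steps. From \<open>y\<close>, at distance at most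
    \<open>l - 1 - d\<close>, the last \<open>d\<close> steps are controlled; together this covers
    the whole path.\<close>
  have ys2: "ys ! (l - 1 - j) \<in> ?b (l - 1 - d + j)" if "j \<le> d" for j
    using that
  proof (induction j)
    case 0
    then show ?case using yb y0 by simp
  next
    case (Suc j)
    define i where "i = l - 1 - Suc j"
    have i: "l - 1 - j = Suc i" "Suc i < l" using Suc.prems dl by (auto simp: i_def)
    have "ys ! Suc i \<in> ?b (l - 1 - d + j)" using Suc i by simp
    moreover from this have "ys ! Suc i \<in> S" using S Suc dl by auto
    then have "{ys ! Suc i, ys ! i} \<in> E" using nbr[of "ys ! Suc i" "ys ! i"] ye[of i] i by (simp add: insert_commute)
    ultimately have "ys ! i \<in> ?b (Suc (l - 1 - d + j))" using nball_step by fastforce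
    then show ?case by (simp add: i_def)
  qed
  have ysS: "ys ! i \<in> S" if "i < l" for i
  proof (cases "d + i \<le> l - 1")
    case True
    then show ?thesis using ys1 S by blast
  next
    case False
    then have "ys ! (l - 1 - (l - 1 - i)) \<in> ?b (l - 1 - d + (l - 1 - i))"
      using that by (intro ys2) auto
    moreover have "l - 1 - (l - 1 - i) = i" using that by auto
    ultimately show ?thesis using S False dl by auto
  qed
  have yN: "ys ! Suc i \<in> N (ys ! i)" if "Suc i < l" for i
    using nbr[OF ysS ye] that by simp
  have neq: "zs ! i \<noteq> zs ! j" if "i \<noteq> j" "i < l" "j < l" "distinct zs" "length zs = l" for zs :: "'a list" and i j
    using that by (simp add: nth_eq_iff_index_eq)
  have last: "ys ! (l - 2) \<noteq> xs ! (l - 2)"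
  proof
    assume "ys ! (l - 2) = xs ! (l - 2)"
    then have "g = {ys ! (l - 2), ys ! Suc (l - 2)}"
      using y0 l3 by (simp add: g_def numeral_2_eq_2 Suc_diff_Suc)
    then show False using ys(1,6) pedgesI[of "l - 2" ys] l3 by simp
  qed
  \<comment> \<open>Inside \<open>S\<close> two consecutive vertices of a path determine the next
    one, so paths with the same first edge would coincide, including the last edge
    \<open>g\<close>.\<close>
  have first: "ys ! 1 \<noteq> xs ! 1"
  proof
    assume eq: "ys ! 1 = xs ! 1"
    have "ys ! i = xs ! i" if "i < l" for i
      using that
    proof (induction i rule: less_induct)
      case (less i)
      consider "i = 0" | "i = 1" | j where "i = Suc (Suc j)"
        by (metis One_nat_def not0_implies_Suc)
      then show ?case
      proof cases
        case 3
        have "ys ! j = xs ! j" "ys ! Suc j = xs ! Suc j" using less 3 by auto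
        then have "N (xs ! Suc j) = {xs ! j, xs ! i}" "N (xs ! Suc j) = {xs ! j, ys ! i}"
          using two[OF xsS, of "Suc j" "xs ! j" "xs ! i"] two[OF xsS, of "Suc j" "xs ! j" "ys ! i"]
            xN[of j] xN[of "Suc j"] yN[of "Suc j"] neq[of j i xs] neq[of j i ys] xs ys less.prems 3 comm
          by auto
        then show ?thesis by (auto simp: doubleton_eq_iff)
      qed (use eq x0 y0 in auto)
    qed
    then show False using last l3 by simp
  qed
  define W where "W = set xs \<union> set ys"
  have inW: "xs ! i \<in> W" "ys ! i \<in> W" if "i < l" for i
    using that xs(1) ys(1) by (auto simp: W_def)
  have inner: "N (zs ! i) \<subseteq> W"
    if "0 < i" "Suc i < l" "zs \<in> {xs, ys}" for i zs
  proof -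
    have zs: "distinct zs" "length zs = l" "\<And>i. i < l \<Longrightarrow> zs ! i \<in> W \<and> zs ! i \<in> S"
      "\<And>i. Suc i < l \<Longrightarrow> zs ! Suc i \<in> N (zs ! i)"
      using that(3) xs ys inW xsS ysS xN yN by auto
    have "i = Suc (i - 1)" using that(1) by simp
    then obtain j where j: "i = Suc j" by blast
    have "zs ! j \<in> N (zs ! i)" "zs ! Suc i \<in> N (zs ! i)" "zs ! j \<noteq> zs ! Suc i"
      using zs(4)[of j] zs(4)[of i] neq[of j "Suc i" zs] zs(1,2) that j comm by auto
    then have "N (zs ! i) = {zs ! j, zs ! Suc i}"
      using two zs(3) that(2) by simp
    then show ?thesis using zs(3)[of j] zs(3)[of "Suc i"] that j by simp
  qed
  have Nx: "N x \<subseteq> W"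
    using two[of x "xs ! 1" "ys ! 1"] first xN[of 0] yN[of 0] x0 y0 x(2) inW[of 1] l3 by auto
  have "xs ! (l - 1) \<in> N (xs ! (l - 2))" "ys ! (l - 1) \<in> N (ys ! (l - 2))"
    using xN[of "l - 2"] yN[of "l - 2"] l3 by (auto simp: numeral_2_eq_2 Suc_diff_Suc)
  then have Ny: "N y \<subseteq> W"
    using two[of y "xs ! (l - 2)" "ys ! (l - 2)"] last x0 y0 xsS[of "l - 1"] inW[of "l - 2"] l3 comm by auto
  have closed: "N u \<subseteq> W" if "u \<in> W" for u
  proof -
    obtain i zs where i: "u = zs ! i" "i < l" "zs \<in> {xs, ys}"
      using \<open>u \<in> W\<close> xs(1) ys(1) by (auto simp: W_def in_set_conv_nth)
    consider "i = 0" | "i = l - 1" | "0 < i" "Suc i < l" using i(2) by linarith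
    then show ?thesis
      by cases (use i x0 y0 Nx Ny inner in auto)
  qed
  have "W \<subseteq> V"
    using xsS ysS SV xs(1) ys(1) unfolding W_def by (metis Un_iff in_set_conv_nth subset_iff)
  moreover have "card W \<le> 2 * l"
    using card_Un_le[of "set xs" "set ys"] xs(1,2) ys(1,2) by (simp add: W_def distinct_card)
  \<comment> \<open>\<open>large\<close> was chosen for this step; the bound \<open>2 * l\<close>
    counts the common ends \<open>x\<close> and \<open>y\<close> twice.\<close>
  then have "W \<noteq> V" using large by auto
  moreover have "W \<noteq> {}" using inW(1)[of 0] l3 by auto
  ultimately show False using no_cut[of W] closed unfolding nbrs_def by blast
qed

section \<open>Counting vertices layer by layer\<close>

lemma finite_nball_B: "finite (nball E B r)"
  by (rule finite_subset[OF nball_subset[of E V] finV]) (use simple in \<open>auto simp: simple_graph_def B_def\<close>)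

text \<open>The first layer lies in the neighborhoods of \<open>B\<close>. A vertex of a layer is
  outside \<open>B\<close>, so it has degree at most 2, and one neighbor lies in the previous ball.
  At most one neighbor leads outwards, so choosing parents is injective and layers never
  grow.\<close>

lemma card_layer_le:
  "card (nball E B (Suc r) - nball E B r) \<le> (\<Sum>b\<in>B. card (N b))"
proof (induction r)
  case 0
  have "finite B" using finite_nball_B[of 0] by simp
  have "card (nball E B 1 - nball E B 0) \<le> card (\<Union>b\<in>B. N b)"
    by (rule card_mono) (use finite_nbrs[OF simple] \<open>finite B\<close> in auto)
  also have "\<dots> \<le> (\<Sum>b\<in>B. card (N b))"
    by (rule card_UN_le[OF \<open>finite B\<close>])
  finally show ?case by simp
next
  case (Suc r)
  let ?L = "\<lambda>r. nball E B (Suc r) - nball E B r"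
  have "\<exists>u \<in> ?L r. w \<in> N u" if w: "w \<in> ?L (Suc r)" for w
  proof -
    obtain u where u: "u \<in> nball E B (Suc r)" "w \<in> N u"
      using w unfolding nball.simps(2)[of E B "Suc r"] by blast
    then have "u \<notin> nball E B r" using w by auto
    with u show ?thesis by blast
  qed
  then obtain p where p: "\<And>w. w \<in> ?L (Suc r) \<Longrightarrow> p w \<in> ?L r \<and> w \<in> N (p w)"
    by metis
  have "inj_on p (?L (Suc r))"
  proof (rule inj_onI, rule ccontr)
    fix w w' assume w: "w \<in> ?L (Suc r)" "w' \<in> ?L (Suc r)" "p w = p w'" "w \<noteq> w'"
    define u where "u = p w"
    have u: "u \<in> ?L r" "w \<in> N u" "w' \<in> N u"
      using p[OF w(1)] p[OF w(2)] w(3) unfolding u_def by metis+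
    then obtain z where z: "z \<in> nball E B r" "z \<in> N u"
      by (auto simp: insert_commute)
    have "w \<notin> nball E B r" "w' \<notin> nball E B r"
      using w(1,2) nball.simps(2)[of E B r] by blast+
    have "u \<notin> B" using u(1) nball_mono[of 0 r u E B] by auto
    moreover have "u \<in> V" using u(2) edge_simple[OF simple] by auto
    ultimately have "card (N u) \<le> 2" by (simp add: B_def)
    moreover have "card {w, w', z} \<le> card (N u)"
      by (rule card_mono[OF finite_nbrs[OF simple]]) (use u z in auto)
    moreover have "card {w, w', z} = 3"
      using \<open>w \<noteq> w'\<close> z(1) \<open>w \<notin> nball E B r\<close> \<open>w' \<notin> nball E B r\<close> by (auto simp: card_insert_if)
    ultimately show False by simp
  qed
  then have "card (?L (Suc r)) \<le> card (?L r)"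
  proof (rule card_inj_on_le)
    show "p ` ?L (Suc r) \<subseteq> ?L r" using p by blast
  qed (rule finite_Diff[OF finite_nball_B])
  then show ?case using Suc.IH by linarith
qed

lemma card_nball_le: "card (nball E B r) \<le> card B + r * (\<Sum>b\<in>B. card (N b))"
proof (induction r)
  case (Suc r)
  have "nball E B (Suc r) = nball E B r \<union> (nball E B (Suc r) - nball E B r)" by auto
  then have "card (nball E B (Suc r)) \<le> card (nball E B r) + card (nball E B (Suc r) - nball E B r)"
    by (metis card_Un_le)
  also have "\<dots> \<le> card B + r * (\<Sum>b\<in>B. card (N b)) + (\<Sum>b\<in>B. card (N b))"
    using Suc card_layer_le[of r] by linarith
  finally show ?case by simp
qed auto

text \<open>With \<open>X\<close> the excess of degrees over \<open>2\<close>, we have \<open>|E| = |V| + X/2\<close>, \<open>|B| \<le> X\<close> and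
  \<open>|V| \<le> |B| + (l - 1) * 3 X \<le> 3 l X\<close>.\<close>

lemma card_edges_ge:
  "real (card V) + real (card V) / (6 * real l) \<le> real (card E)"
proof -
  define X where "X = (\<Sum>b\<in>B. card (N b) - 2)"
  have BV: "B \<subseteq> V" "finite B" using finV by (auto simp: B_def intro: finite_subset)
  have "2 * card E = (\<Sum>v\<in>V. 2 + (card (N v) - 2))"
    unfolding handshake[OF simple, symmetric]
    by (intro sum.cong refl) (metis degree_ge_2 le_add_diff_inverse)
  also have "\<dots> = 2 * card V + (\<Sum>v\<in>V. card (N v) - 2)"
    by (subst sum.distrib) simp
  \<comment> \<open>Truncated subtraction makes the terms outside \<open>B\<close> vanish.\<close>
  also have "(\<Sum>v\<in>V. card (N v) - 2) = X"
    unfolding X_def by (intro sum.mono_neutral_right finV BV) (auto simp: B_def)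
  finally have E: "2 * card E = 2 * card V + X" .
  have "card B = (\<Sum>b\<in>B. 1)" by simp
  also have "\<dots> \<le> X" unfolding X_def by (intro sum_mono) (auto simp: B_def)
  finally have B: "card B \<le> X" .
  \<comment> \<open>Every degree d >= 3 satisfies d <= 3 (d - 2). Together with the factor 2 of the
    handshake identity this gives the 6 in the bound.\<close>
  have "(\<Sum>b\<in>B. card (N b)) \<le> (\<Sum>b\<in>B. 3 * (card (N b) - 2))"
    by (intro sum_mono) (auto simp: B_def)
  then have deg: "(\<Sum>b\<in>B. card (N b)) \<le> 3 * X" by (simp add: X_def sum_distrib_left)
  have "card V \<le> card (nball E B (l - 1))"
    by (intro card_mono finite_nball_B) (use near_B in auto)
  also have "\<dots> \<le> X + (l - 1) * (3 * X)"
    using card_nball_le[of "l - 1"] B mult_le_mono2[OF deg, of "l - 1"] by linarith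
  also have "\<dots> \<le> 3 * l * X"
    using l3 by (cases l) (auto simp: algebra_simps)
  finally have "real (card V) \<le> 3 * real l * real X"
    by (metis of_nat_le_iff of_nat_mult of_nat_numeral)
  then have "real (card V) / (6 * real l) \<le> real X / 2"
    using l3 by (simp add: field_simps)
  moreover have "2 * real (card E) = 2 * real (card V) + real X"
    using E by (metis of_nat_add of_nat_mult of_nat_numeral)
  ultimately show ?thesis by linarith
qed

end

section \<open>The upper bound\<close>

lemma pedges_subset_iff: "pedges xs \<subseteq> X \<longleftrightarrow> successively (\<lambda>x y. {x, y} \<in> X) xs"
  by (induction xs rule: induct_list012) auto

lemma pedges_clique:
  assumes "distinct xs" "\<And>a b. a \<in> set xs \<Longrightarrow> b \<in> set xs \<Longrightarrow> a \<noteq> b \<Longrightarrow> {a, b} \<in> X"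
  shows "pedges xs \<subseteq> X"
  using assms by (induction xs rule: induct_list012) auto

lemma successively_upt: "(\<And>i. a \<le> i \<Longrightarrow> Suc i < b \<Longrightarrow> R i (Suc i)) \<Longrightarrow> successively R [a..<b]"
  by (auto simp: successively_conv_nth)

lemma ex_distinct_list:
  assumes "finite A" "k \<le> card A"
  obtains xs where "distinct xs" "set xs \<subseteq> A" "length xs = k"
proof -
  obtain T where T: "T \<subseteq> A" "card T = k"
    using obtain_subset_with_card_n[OF assms(2)] by auto
  then obtain xs where "set xs = T" "distinct xs"
    using finite_distinct_list finite_subset[OF T(1) assms(1)] by blast
  then show ?thesis using that[of xs] T distinct_card[of xs] by simp
qed

definition addable :: "nat \<Rightarrow> 'a ugraph \<Rightarrow> ('a set \<Rightarrow> 'c) \<Rightarrow> 'a set set \<Rightarrow> 'a set \<Rightarrow> bool" where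
  "addable l F col A e \<longleftrightarrow>
     (\<forall>c. inj_on c (complement_edges F) \<longrightarrow>
        rainbow_copy_containing (cycle_graph l) (add_edges F (insert e A))
          (\<lambda>e. if e \<in> edges F then col e else c e) e)"

text \<open>An ordering can be built greedily as long as no proper subset of the complement is
  stuck. Later arguments work with a stuck set instead of an explicit ordering.\<close>

lemma weakly_rainbow_saturatedI:
  assumes fin: "finite (complement_edges F)"
    and ex: "\<And>A. A \<subset> complement_edges F \<Longrightarrow> \<exists>e \<in> complement_edges F - A. addable l F col A e"
  shows "weakly_rainbow_saturated K (cycle_graph l) F col"
proof -
  let ?C = "complement_edges F"
  have "\<exists>es. distinct es \<and> set es \<subseteq> ?C \<and> length es = k \<and>
          (\<forall>i<k. addable l F col (set (take i es)) (es ! i))" if "k \<le> card ?C" for k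
    using that
  proof (induction k)
    case (Suc k)
    then obtain es where es: "distinct es" "set es \<subseteq> ?C" "length es = k"
      "\<And>i. i < k \<Longrightarrow> addable l F col (set (take i es)) (es ! i)" by auto
    have "set es \<noteq> ?C" using es(1,3) Suc.prems distinct_card by fastforce
    then obtain e where e: "e \<in> ?C - set es" "addable l F col (set es) e"
      using ex[of "set es"] es(2) by blast
    have "addable l F col (set (take i (es @ [e]))) ((es @ [e]) ! i)" if "i < Suc k" for i
      using that es e(2) by (cases "i < k") (auto simp: nth_append less_Suc_eq)
    then show ?case using es e by (intro exI[of _ "es @ [e]"]) auto
  qed auto
  then obtain es where es: "distinct es" "set es \<subseteq> ?C" "length es = card ?C"
    "\<And>i. i < card ?C \<Longrightarrow> addable l F col (set (take i es)) (es ! i)"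
    by blast
  have "set es = ?C"
    using es(1-3) fin by (metis card_subset_eq distinct_card)
  moreover have "insert (es ! i) (set (take i es)) = set (take (Suc i) es)" if "i < length es" for i
    using that by (simp add: take_Suc_conv_app_nth)
  ultimately show ?thesis
    unfolding weakly_rainbow_saturated_def using es(1,3,4) unfolding addable_def by metis
qed

section \<open>The clique with its joined independent set and its ears\<close>

locale ear_graph =
  fixes l m t :: nat
  assumes l4: "l \<ge> 4" and m: "m \<ge> 4 * l"
begin

text \<open>The inner vertices of the \<open>j\<close>-th ear are \<open>base j + r\<close> for \<open>r \<le> l - 2\<close>; its ends are \<open>0\<close> and \<open>1\<close>.\<close>

definition base :: "nat \<Rightarrow> nat" where "base j = m + j * (l - 1)"
definition V :: "nat set" where "V = {..<base t}"
definition Z :: "nat set" where "Z = {2 * l..<m}"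

text \<open>As \<open>b\<close> ranges over the clique \<open>{..<2 * l}\<close> and over
  \<open>Z\<close>, this is the clique together with its complete join to \<open>Z\<close>.\<close>

definition core_edges :: "nat set set" where
  "core_edges = {{a, b} |a b. a < 2 * l \<and> b < m \<and> a \<noteq> b}"

definition ear_edges :: "nat \<Rightarrow> nat set set" where
  "ear_edges j = {{0, base j}, {1, base j + (l - 2)}} \<union> (\<lambda>i. {base j + i, Suc (base j + i)}) ` {..<l - 2}"

definition E :: "nat set set" where "E = core_edges \<union> (\<Union>j<t. ear_edges j)"

definition G :: "nat ugraph" where "G = (V, E)"

lemma base_le: "j < t \<Longrightarrow> base j + (l - 1) \<le> base t"
  unfolding base_def using mult_le_mono1[of "Suc j" t "l - 1"] by simp

lemma m_le_base: "m \<le> base j" by (simp add: base_def)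

lemma ear_vertex:
  assumes "m \<le> v" "v < base t"
  obtains j r where "j < t" "r \<le> l - 2" "v = base j + r"
proof -
  have "(v - m) div (l - 1) < t"
    using assms l4 by (intro less_mult_imp_div_less) (auto simp: base_def)
  moreover have "(v - m) mod (l - 1) < l - 1" using l4 by simp
  then have "(v - m) mod (l - 1) \<le> l - 2" by linarith
  moreover have "v = base ((v - m) div (l - 1)) + (v - m) mod (l - 1)"
    using assms(1) div_mult_mod_eq[of "v - m" "l - 1"] unfolding base_def by linarith
  ultimately show ?thesis using that by blast
qed

lemma core_edge: "a < 2 * l \<Longrightarrow> b < m \<Longrightarrow> a \<noteq> b \<Longrightarrow> {a, b} \<in> E"
  unfolding E_def core_edges_def by blast

lemma ear_edge:
  assumes "j < t"
  shows "{0, base j} \<in> E" "{1, base j + (l - 2)} \<in> E"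
    "i < l - 2 \<Longrightarrow> {base j + i, Suc (base j + i)} \<in> E"
  using assms unfolding E_def ear_edges_def by blast+

text \<open>This coarse description of \<open>E\<close> suffices to recognize non-edges at
  \<open>Z\<close>: edges of the second kind have both ends at least \<open>m\<close>, beyond
  \<open>Z\<close>.\<close>

lemma E_endpoint:
  assumes "e \<in> E"
  obtains a where "a \<in> e" "a < 2 * l" | j i where "e = {base j + i, Suc (base j + i)}"
proof -
  consider "e \<in> core_edges" | j where "e \<in> ear_edges j"
    using assms by (auto simp: E_def)
  then show ?thesis
  proof cases
    case 1
    then show ?thesis using that(1) by (auto simp: core_edges_def)
  next
    case 2
    then show ?thesis using that(1)[of 0] that(1)[of 1] that(2) l4 by (auto simp: ear_edges_def)
  qed
qed

lemma Z_not_E: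
  assumes "z \<in> Z" "2 * l \<le> v"
  shows "{v, z} \<notin> E"
proof
  assume "{v, z} \<in> E"
  then show False
    using assms m_le_base
    by (elim E_endpoint) (auto simp: Z_def doubleton_eq_iff not_le dest: leD order.strict_trans2 Suc_lessD)
qed

lemma E_subset: "E \<subseteq> [V]\<^bsup>2\<^esup>"
proof
  fix e assume "e \<in> E"
  then consider a b where "e = {a, b}" "a < 2 * l" "b < m" "a \<noteq> b" | j where "j < t" "e \<in> ear_edges j"
    by (auto simp: E_def core_edges_def)
  then show "e \<in> [V]\<^bsup>2\<^esup>"
  proof cases
    case 1
    then show ?thesis using m m_le_base[of t] by (auto simp: V_def)
  next
    case 2
    then show ?thesis using base_le[of j] m_le_base[of j] m l4 by (auto simp: V_def ear_edges_def)
  qed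
qed

lemma simple: "simple_graph G"
  using E_subset by (auto simp: simple_graph_def G_def V_def)

lemma finite_E: "finite E"
  using finite_edges[OF simple] by (simp add: G_def)

lemma card_ear_edges: "card (ear_edges j) \<le> l"
proof -
  have "card (ear_edges j) \<le> card {{0, base j}, {1, base j + (l - 2)}}
      + card ((\<lambda>i. {base j + i, Suc (base j + i)}) ` {..<l - 2})"
    unfolding ear_edges_def by (rule card_Un_le)
  also have "\<dots> \<le> 2 + (l - 2)"
    using card_image_le[of "{..<l - 2}" "\<lambda>i. {base j + i, Suc (base j + i)}"]
    by (intro add_mono) (auto simp: card_insert_if)
  finally show ?thesis using l4 by simp
qed

text \<open>The core is bounded crudely by all pairs among its \<open>m\<close> vertices, which is
  the source of the binomial term.\<close>

lemma card_E: "card E \<le> t * l + (m choose 2)"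
proof -
  have "core_edges \<subseteq> {B. B \<subseteq> {..<m} \<and> card B = 2}"
    using m by (auto simp: core_edges_def card_insert_if)
  then have "card core_edges \<le> m choose 2"
    using card_mono[of "{B. B \<subseteq> {..<m} \<and> card B = 2}" core_edges] n_subsets[of "{..<m}" 2] by simp
  moreover have "card (\<Union>j<t. ear_edges j) \<le> (\<Sum>j<t. card (ear_edges j))"
    by (rule card_UN_le) simp
  then have "card (\<Union>j<t. ear_edges j) \<le> t * l"
    using sum_bounded_above[of "{..<t}" "\<lambda>j. card (ear_edges j)" l] card_ear_edges by simp
  ultimately show ?thesis
    using card_Un_le[of core_edges "\<Union>j<t. ear_edges j"] by (simp add: E_def)
qed

text \<open>The clique vertices pad the path along the ear to exactly \<open>l\<close> vertices.
  This works for \<open>r \<le> l - 3\<close>, and in \<open>right\<close> for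
  \<open>r \<ge> 1\<close>; at the remaining ear vertex the list has one entry too many. For
  \<open>r = 1\<close> the list \<open>right\<close> uses no clique vertex besides \<open>1\<close>,
  so the two lists share only their ends.\<close>

definition left :: "nat \<Rightarrow> nat \<Rightarrow> nat \<Rightarrow> nat list" where
  "left j r z = rev [base j..<Suc (base j + r)] @ 0 # [2..<l - 1 - r] @ [z]"

definition right :: "nat \<Rightarrow> nat \<Rightarrow> nat \<Rightarrow> nat list" where
  "right j r z = [base j + r..<base j + (l - 1)] @ 1 # [2..<Suc r] @ [z]"

lemma core_edge':
  assumes "a < m" "b < m" "a \<noteq> b" "a < 2 * l \<or> b < 2 * l"
  shows "{a, b} \<in> E"
  using core_edge[of a b] core_edge[of b a] assms by (metis insert_commute)

lemma core_path:
  assumes "a < 2" "k \<le> 2 * l" "z \<in> Z"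
  shows "pedges (a # [2..<k] @ [z]) \<subseteq> E"
proof (rule pedges_clique)
  show "distinct (a # [2..<k] @ [z])" using assms l4 by (auto simp: Z_def)
next
  fix u v assume "u \<in> set (a # [2..<k] @ [z])" "v \<in> set (a # [2..<k] @ [z])" "u \<noteq> v"
  then show "{u, v} \<in> E"
    using assms m l4 by (intro core_edge') (auto simp: Z_def)
qed

lemma left:
  assumes "j < t" "r \<le> l - 3" "z \<in> Z"
  shows "length (left j r z) = l" "distinct (left j r z)" "hd (left j r z) = base j + r"
    "last (left j r z) = z" "pedges (left j r z) \<subseteq> E"
proof -
  have ge: "base j \<ge> 4 * l" using m m_le_base[of j] by simp
  have "z \<ge> 2 * l" "z < base j" using assms m_le_base[of j] by (auto simp: Z_def)
  then show "distinct (left j r z)"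
    using assms(2) ge l4 by (simp add: left_def del: upt_Suc)
  show "length (left j r z) = l"
    using assms(2) l4 by (simp add: left_def del: upt_Suc)
  show "hd (left j r z) = base j + r" "last (left j r z) = z"
    by (simp_all add: left_def)
  have "successively (\<lambda>x y. {x, y} \<in> E) (0 # [2..<l - 1 - r] @ [z])"
    using core_path[of 0 "l - 1 - r" z] assms(3) l4 by (simp add: pedges_subset_iff)
  moreover have "successively (\<lambda>x y. {x, y} \<in> E) [base j..<Suc (base j + r)]"
  proof (rule successively_upt)
    fix i assume "base j \<le> i" "Suc i < Suc (base j + r)"
    then show "{i, Suc i} \<in> E"
      using ear_edge(3)[OF assms(1), of "i - base j"] assms(2) by simp
  qed
  then have "successively (\<lambda>x y. {x, y} \<in> E) (rev [base j..<Suc (base j + r)])"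
    by (simp add: successively_rev insert_commute del: upt_Suc)
  moreover have "{base j, 0} \<in> E" using ear_edge(1)[OF assms(1)] by (simp add: insert_commute)
  ultimately show "pedges (left j r z) \<subseteq> E"
    unfolding pedges_subset_iff left_def by (subst successively_append_iff) (auto simp: last_rev simp del: upt_Suc)
qed

lemma right:
  assumes "j < t" "1 \<le> r" "r \<le> l - 2" "z \<in> Z"
  shows "length (right j r z) = l" "distinct (right j r z)" "hd (right j r z) = base j + r"
    "last (right j r z) = z" "pedges (right j r z) \<subseteq> E"
proof -
  have ge: "base j \<ge> 4 * l" using m m_le_base[of j] by simp
  have "z \<ge> 2 * l" "z < base j" using assms m_le_base[of j] by (auto simp: Z_def)
  then show "distinct (right j r z)"
    using assms(2,3) ge l4 by (simp add: right_def del: upt_Suc)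
  show "length (right j r z) = l"
    using assms(2,3) l4 by (simp add: right_def del: upt_Suc)
  show "hd (right j r z) = base j + r" "last (right j r z) = z"
    using assms(3) l4 by (auto simp add: right_def hd_append simp del: upt_Suc)
  have "successively (\<lambda>x y. {x, y} \<in> E) (1 # [2..<Suc r] @ [z])"
    using core_path[of 1 "Suc r" z] assms l4 by (simp add: pedges_subset_iff del: upt_Suc)
  moreover have "successively (\<lambda>x y. {x, y} \<in> E) [base j + r..<base j + (l - 1)]"
  proof (rule successively_upt)
    fix i assume "base j + r \<le> i" "Suc i < base j + (l - 1)"
    then show "{i, Suc i} \<in> E"
      using ear_edge(3)[OF assms(1), of "i - base j"] by simp
  qed
  moreover have "last [base j + r..<base j + (l - 1)] = base j + (l - 2)"
    using assms(3) l4 by (subst last_upt) auto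
  then have "{last [base j + r..<base j + (l - 1)], 1} \<in> E"
    using ear_edge(2)[OF assms(1)] by (simp add: insert_commute)
  ultimately show "pedges (right j r z) \<subseteq> E"
    unfolding pedges_subset_iff right_def by (subst successively_append_iff) (auto simp del: upt_Suc)
qed


section \<open>Criteria for rainbow cycles, and filling the complement\<close>

abbreviation C :: "nat set set" where "C \<equiv> complement_edges G"

abbreviation joint :: "(nat set \<Rightarrow> 'c) \<Rightarrow> (nat set \<Rightarrow> 'c) \<Rightarrow> nat set \<Rightarrow> 'c" where
  "joint col c \<equiv> (\<lambda>e. if e \<in> edges G then col e else c e)"

lemma C_iff: "{x, y} \<in> C \<longleftrightarrow> x \<in> V \<and> y \<in> V \<and> x \<noteq> y \<and> {x, y} \<notin> E"
  by (simp add: doubleton_in_complement G_def)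

lemma notin_E: "e \<in> C \<Longrightarrow> e \<notin> E"
  by (auto simp: complement_edges_def G_def)

lemma rainbow_pathI:
  assumes "A \<subseteq> C" "{hd xs, last xs} \<in> C" "length xs = l" "distinct xs" "pedges xs \<subseteq> E \<union> A"
    "inj_on (joint col c) (insert {hd xs, last xs} (pedges xs))"
  shows "rainbow_copy_containing (cycle_graph l) (add_edges G (insert {hd xs, last xs} A)) (joint col c) {hd xs, last xs}"
proof (rule rainbow_cycleI)
  have "set xs \<subseteq> \<Union> (pedges xs)"
  proof
    fix v assume "v \<in> set xs"
    then obtain i where i: "i < length xs" "v = xs ! i" by (auto simp: in_set_conv_nth)
    consider "Suc i < length xs" | k where "i = Suc k"
      using i(1) assms(3) l4 by (cases i) auto
    then show "v \<in> \<Union> (pedges xs)"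
      by cases (use i pedgesI[of i xs] pedgesI[of "i - 1" xs] in auto)
  qed
  also have "\<Union> (pedges xs) \<subseteq> V"
    using assms(1,5) E_subset unfolding complement_edges_def G_def nsets_def by fastforce
  finally show "set xs \<subseteq> verts (add_edges G (insert {hd xs, last xs} A))"
    by (simp add: add_edges_def G_def)
  show "insert {hd xs, last xs} (pedges xs) \<subseteq> edges (add_edges G (insert {hd xs, last xs} A))"
    using assms(5) by (auto simp: add_edges_def G_def)
qed (use assms l4 in auto)

text \<open>As \<open>col\<close> is injective on \<open>E\<close>, the color of the new edge is the
  only possible source of a conflict.\<close>

lemma rainbow_E:
  assumes "A \<subseteq> C" "{hd xs, last xs} \<in> C" "length xs = l" "distinct xs" "pedges xs \<subseteq> E"
    and "inj_on col E" "c {hd xs, last xs} \<notin> col ` pedges xs"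
  shows "rainbow_copy_containing (cycle_graph l) (add_edges G (insert {hd xs, last xs} A)) (joint col c) {hd xs, last xs}"
proof (rule rainbow_pathI[OF assms(1-4)])
  have "inj_on (joint col c) (pedges xs) = inj_on col (pedges xs)"
    by (rule inj_on_cong) (use assms(5) in \<open>auto simp: G_def\<close>)
  moreover have "joint col c ` pedges xs = col ` pedges xs"
    by (rule image_cong) (use assms(5) in \<open>auto simp: G_def\<close>)
  ultimately show "inj_on (joint col c) (insert {hd xs, last xs} (pedges xs))"
    using assms(5-7) notin_E[OF assms(2)] by (auto simp: G_def intro: inj_on_subset)
qed (use assms in auto)

lemma rainbow_C:
  assumes "A \<subseteq> C" "{hd xs, last xs} \<in> C" "length xs = l" "distinct xs" "pedges xs \<subseteq> A"
    and "inj_on c C"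
  shows "rainbow_copy_containing (cycle_graph l) (add_edges G (insert {hd xs, last xs} A)) (joint col c) {hd xs, last xs}"
proof (rule rainbow_pathI[OF assms(1-4)])
  have sub: "insert {hd xs, last xs} (pedges xs) \<subseteq> C" using assms by auto
  have "inj_on (joint col c) (insert {hd xs, last xs} (pedges xs)) = inj_on c (insert {hd xs, last xs} (pedges xs))"
    by (rule inj_on_cong) (use sub notin_E in \<open>auto simp: G_def\<close>)
  then show "inj_on (joint col c) (insert {hd xs, last xs} (pedges xs))"
    using inj_on_subset[OF assms(6) sub] by (simp only:)
qed (use assms in auto)

text \<open>Complement edges never share colors with each other, so a cycle with a single edge of \<open>E\<close> is rainbow
  as soon as no complement edge in it takes that edge's color.\<close>

lemma rainbow_mixed:
  assumes "A \<subseteq> C" "{r, last ps} \<in> C" "length ps = l - 1" "distinct (r # ps)" "pedges ps \<subseteq> A"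
    and g: "{r, hd ps} \<in> E" and "inj_on c C"
    and "c {r, last ps} \<noteq> col {r, hd ps}" "\<And>d. d \<in> pedges ps \<Longrightarrow> c d \<noteq> col {r, hd ps}"
  shows "rainbow_copy_containing (cycle_graph l) (add_edges G (insert {r, last ps} A)) (joint col c) {r, last ps}"
proof -
  have ne: "ps \<noteq> []" using assms(3) l4 by auto
  then have pe: "pedges (r # ps) = insert {r, hd ps} (pedges ps)"
    by (cases ps) auto
  have ends: "{hd (r # ps), last (r # ps)} = {r, last ps}" using ne by simp
  have sub: "insert {r, last ps} (pedges ps) \<subseteq> C" using assms by auto
  have "inj_on (joint col c) (insert {r, last ps} (pedges ps)) = inj_on c (insert {r, last ps} (pedges ps))"
    by (rule inj_on_cong) (use sub notin_E in \<open>auto simp: G_def\<close>)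
  then have "inj_on (joint col c) (insert {r, last ps} (pedges ps))"
    using inj_on_subset[OF assms(7) sub] by (simp only:)
  moreover have "joint col c {r, hd ps} \<notin> joint col c ` insert {r, last ps} (pedges ps)"
  proof -
    have "joint col c ` insert {r, last ps} (pedges ps) = c ` insert {r, last ps} (pedges ps)"
      by (rule image_cong) (use sub notin_E in \<open>auto simp: G_def\<close>)
    moreover have "joint col c {r, hd ps} = col {r, hd ps}" using g by (simp add: G_def)
    moreover have "col {r, hd ps} \<notin> c ` insert {r, last ps} (pedges ps)"
    proof
      assume "col {r, hd ps} \<in> c ` insert {r, last ps} (pedges ps)"
      then obtain d where "d \<in> insert {r, last ps} (pedges ps)" "col {r, hd ps} = c d" by (rule imageE)
      then show False using assms(8) assms(9)[of d] by (metis insertE)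
    qed
    ultimately show ?thesis by (simp only: not_False_eq_True)
  qed
  ultimately have "inj_on (joint col c) (insert {r, hd ps} (insert {r, last ps} (pedges ps)))"
    by (subst inj_on_insert) blast
  then have "inj_on (joint col c) (insert {hd (r # ps), last (r # ps)} (pedges (r # ps)))"
    unfolding pe ends by (simp add: insert_commute)
  then show ?thesis
    using rainbow_pathI[of A "r # ps" col c] assms ends pe l4 by auto
qed

text \<open>At most one complement edge \<open>h\<close> has color \<open>k\<close>; omitting one of its vertices from \<open>Z\<close> avoids it.\<close>

lemma Z_path:
  assumes A: "A \<subseteq> C" "inj_on c C" and Z: "\<And>y z. y \<in> Z \<Longrightarrow> z \<in> Z \<Longrightarrow> y \<noteq> z \<Longrightarrow> {y, z} \<in> A"
    and s: "s \<notin> Z" "\<And>z. z \<in> Z \<Longrightarrow> {s, z} \<in> A" and w: "w \<in> Z"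
  obtains ps where "length ps = l - 1" "distinct ps" "hd ps = s" "last ps = w" "set ps \<subseteq> insert s Z"
    "pedges ps \<subseteq> A" "\<And>d. d \<in> pedges ps \<Longrightarrow> c d \<noteq> k"
proof -
  obtain h where h: "\<And>d. d \<in> C \<Longrightarrow> c d = k \<Longrightarrow> d = h"
  proof (cases "\<exists>d \<in> C. c d = k")
    case True
    then obtain h where "h \<in> C" "c h = k" by blast
    then show ?thesis using that[of h] inj_onD[OF A(2)] by metis
  qed (use that in blast)
  \<comment> \<open>If \<open>h\<close> has no vertex in \<open>Z\<close> other than
    \<open>w\<close>, then \<open>u\<close> is arbitrary; \<open>h\<close> could then only join the
    ends \<open>s\<close> and \<open>w\<close> of the path, which is excluded below.\<close>
  obtain u where u: "h \<inter> (Z - {w}) \<noteq> {} \<Longrightarrow> u \<in> h \<inter> (Z - {w})" by blast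
  have "card Z - card {w, u} \<le> card (Z - {w, u})"
    by (rule diff_card_le_card_Diff) simp
  moreover have "card {w, u} \<le> 2" "card Z \<ge> 2 * l"
    using m by (auto simp: Z_def card_insert_if)
  moreover have "2 * l - 2 \<ge> l - 3" using l4 by simp
  ultimately have "card (Z - {w, u}) \<ge> l - 3" by linarith
  moreover have "finite (Z - {w, u})" by (simp add: Z_def)
  ultimately obtain zs where zs: "distinct zs" "set zs \<subseteq> Z - {w, u}" "length zs = l - 3"
    using ex_distinct_list by metis
  define ps where "ps = s # zs @ [w]"
  have ps: "length ps = l - 1" "distinct ps" "hd ps = s" "last ps = w" "set ps \<subseteq> insert s Z"
    using zs s w l4 by (auto simp: ps_def)
  have "pedges ps \<subseteq> A"
  proof (rule pedges_clique[OF ps(2)])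
    fix a b assume "a \<in> set ps" "b \<in> set ps" "a \<noteq> b"
    then show "{a, b} \<in> A"
      using ps(5) Z s(2) by (metis insert_commute insertE subsetD)
  qed
  moreover have "h \<notin> pedges ps"
  proof
    assume hp: "h \<in> pedges ps"
    then have sub: "h \<subseteq> set ps" by (rule pedges_subset)
    have "h \<inter> (Z - {w}) = {}"
    proof (rule ccontr)
      assume "h \<inter> (Z - {w}) \<noteq> {}"
      then have "u \<in> h" "u \<in> Z" "u \<noteq> w" using u by auto
      then have "u \<in> set ps" "u \<noteq> s" using sub s(1) by auto
      then show False using zs(2) \<open>u \<noteq> w\<close> by (auto simp: ps_def)
    qed
    then have "h \<subseteq> {s, w}" using sub ps(5) by blast
    moreover have "card h = 2"
      using hp \<open>pedges ps \<subseteq> A\<close> A(1) by (auto simp: complement_edges_def nsets_def)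
    ultimately have "h = {s, w}"
      by (metis card_2_iff doubleton_eq_iff insert_subset singletonD insertE)
    \<comment> \<open>The ends are not consecutive because the path has \<open>l - 1 \<ge> 3\<close>
      vertices; this uses \<open>l \<ge> 4\<close>.\<close>
    then show False
      using ends_notin_pedges[OF ps(2)] ps hp l4 by simp
  qed
  ultimately show ?thesis
    using that[of ps] ps h A(1) by blast
qed

text \<open>The new edge shares its color with at most one edge of \<open>E\<close>. No edge lies on
  both paths, since it would have to be \<open>{x, y}\<close> itself. Hence one of the two cycles is
  rainbow.\<close>

lemma addable_two:
  fixes col :: "nat set \<Rightarrow> 'c"
  assumes col: "inj_on col E" and A: "A \<subseteq> C" and e: "{x, y} \<in> C"
    and P: "length P = l" "distinct P" "hd P = x" "last P = y" "pedges P \<subseteq> E"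
    and Q: "length Q = l" "distinct Q" "hd Q = x" "last Q = y" "pedges Q \<subseteq> E"
    and PQ: "set P \<inter> set Q \<subseteq> {x, y}"
  shows "addable l G col A {x, y}"
  unfolding addable_def
proof (intro allI impI)
  fix c :: "nat set \<Rightarrow> 'c" assume "inj_on c C"
  have "False" if im: "c {x, y} \<in> col ` pedges P" "c {x, y} \<in> col ` pedges Q"
  proof -
    obtain p where p: "c {x, y} = col p" "p \<in> pedges P" using im(1) by (rule imageE)
    obtain q where q: "c {x, y} = col q" "q \<in> pedges Q" using im(2) by (rule imageE)
    have "col p = col q" using p(1) q(1) by (rule subst)
    moreover have pE: "p \<in> E" using P(5) p(2) by (rule subsetD)
    moreover have "q \<in> E" using Q(5) q(2) by (rule subsetD)
    ultimately have "p = q" by (rule inj_onD[OF col])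
    then have "p \<subseteq> {x, y}" using p(2) q(2) pedges_subset PQ by blast
    moreover have "p \<in> [V]\<^bsup>2\<^esup>" using E_subset pE by (rule subsetD)
    then have "card p = 2" by (simp add: nsets_def)
    moreover have "card {x, y} = 2" using e by (auto simp: C_iff)
    ultimately have "p = {x, y}" by (simp add: card_subset_eq)
    then show False using pE notin_E[OF e] by simp
  qed
  then consider "c {x, y} \<notin> col ` pedges P" | "c {x, y} \<notin> col ` pedges Q" by blast
  then show "rainbow_copy_containing (cycle_graph l) (add_edges G (insert {x, y} A)) (joint col c) {x, y}"
  proof cases
    case 1
    then show ?thesis using rainbow_E[of A P col c] A e P col by simp
  next
    case 2
    then show ?thesis using rainbow_E[of A Q col c] A e Q col by simp
  qed
qed

text \<open>A stuck set \<open>A\<close> contains every complement edge addable over it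
  (\<open>add\<close>). The classes of complement edges are shown to lie in \<open>A\<close> in
  turn: inside \<open>Z\<close>, from ears to \<open>Z\<close>, from the clique to ears, and between
  ear vertices. Then nothing is left of \<open>C\<close>.\<close>

lemma ex_addable:
  fixes col :: "nat set \<Rightarrow> 'c"
  assumes col: "inj_on col E" and A: "A \<subset> C"
  shows "\<exists>e \<in> C - A. addable l G col A e"
proof (rule ccontr)
  assume no: "\<not> ?thesis"
  have AC: "A \<subseteq> C" using A by auto
  have add: "e \<in> A" if "e \<in> C" "addable l G col A e" for e using no that by auto
  have inV: "v \<in> V" if "v < m" for v using that m_le_base[of t] by (simp add: V_def)
  have ZV: "z \<in> V" "z < m" "2 * l \<le> z" if "z \<in> Z" for z using that inV by (auto simp: Z_def)
  have earV: "base j + r \<in> V" "base j + r \<notin> Z" "base j + r \<ge> m" if "j < t" "r \<le> l - 2" for j r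
    using that base_le[of j] m_le_base[of j] l4 by (auto simp: V_def Z_def)
  have ZZ: "{y, z} \<in> A" if "y \<in> Z" "z \<in> Z" "y \<noteq> z" for y z
  proof -
    have C: "{y, z} \<in> C" using that ZV Z_not_E by (auto simp: C_iff)
    \<comment> \<open>The blocks of \<open>l - 2\<close> clique vertices starting at
      \<open>0\<close> and at \<open>l - 2\<close> are disjoint, and both fit into the clique of
      size \<open>2 * l\<close>.\<close>
    define P where "P k = y # [k..<k + (l - 2)] @ [z]" for k
    have P: "pedges (P k) \<subseteq> E" "distinct (P k)" "length (P k) = l" "hd (P k) = y" "last (P k) = z"
      if "k + (l - 2) \<le> 2 * l" for k
    proof -
      show "distinct (P k)" "length (P k) = l" "hd (P k) = y" "last (P k) = z"
        using that ZV[OF \<open>y \<in> Z\<close>] ZV[OF \<open>z \<in> Z\<close>] \<open>y \<noteq> z\<close> l4 by (auto simp: P_def)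
      have "successively (\<lambda>u v. {u, v} \<in> E) [k..<k + (l - 2)]"
        using that m l4 by (intro successively_upt core_edge) auto
      moreover have "{y, k} \<in> E" "{k + (l - 2) - 1, z} \<in> E"
        using that m ZV[OF \<open>y \<in> Z\<close>] ZV[OF \<open>z \<in> Z\<close>] l4 by (auto intro!: core_edge')
      moreover have "[k..<k + (l - 2)] \<noteq> []" "hd [k..<k + (l - 2)] = k"
        "last [k..<k + (l - 2)] = k + (l - 2) - 1"
        using l4 by auto
      ultimately have "successively (\<lambda>u v. {u, v} \<in> E) (P k)"
        unfolding P_def by (simp add: successively_append_iff successively_Cons hd_append del: upt_eq_Nil_conv hd_upt last_upt)
      then show "pedges (P k) \<subseteq> E" by (simp add: pedges_subset_iff)
    qed
    have "set (P 0) \<inter> set (P (l - 2)) \<subseteq> {y, z}" using l4 by (auto simp: P_def)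
    then have "addable l G col A {y, z}"
      by (intro addable_two[OF col AC C P(3,2,4,5,1) P(3,2,4,5,1)]) auto
    then show ?thesis using add C by blast
  qed
  have earZC: "{base j + r, z} \<in> C" if "j < t" "r \<le> l - 2" "z \<in> Z" for j r z
    using that earV[of j r] ZV[of z] Z_not_E[of z "base j + r"] m by (auto simp: C_iff)
  have ear1: "{base j + 1, z} \<in> A" if "j < t" "z \<in> Z" for j z
  proof -
    have C: "{base j + 1, z} \<in> C" using earZC[of j 1 z] that l4 by simp
    have "set (left j 1 z) \<inter> set (right j 1 z) \<subseteq> {base j + 1, z}"
      using m_le_base[of j] m l4 by (auto simp: left_def right_def)
    then have "addable l G col A {base j + 1, z}"
      using left[of j 1 z] right[of j 1 z] that l4 by (intro addable_two[OF col AC C]) auto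
    then show ?thesis using add C by blast
  qed
  \<comment> \<open>If \<open>{r, w}\<close> has the color of \<open>{r, s}\<close>, no other edge
    of \<open>E\<close> has this color, so the path \<open>R\<close> avoiding \<open>s\<close>
    closes a rainbow cycle. Otherwise the cycle goes from \<open>r\<close> to \<open>s\<close> and
    on through \<open>Z\<close>, where \<open>Z_path\<close> avoids the color of
    \<open>{r, s}\<close>.\<close>
  have spread: "{r, w} \<in> A"
    if rs: "{r, s} \<in> E" "{r, w} \<in> C" "r \<notin> Z" "r \<noteq> s" "w \<in> Z" "s \<notin> Z" "\<And>z. z \<in> Z \<Longrightarrow> {s, z} \<in> A"
      and R: "length R = l" "distinct R" "hd R = r" "last R = w" "pedges R \<subseteq> E" "s \<notin> set R" for r s w R
  proof -
    have "addable l G col A {r, w}"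
      unfolding addable_def
    proof (intro allI impI)
      fix c :: "nat set \<Rightarrow> 'c" assume c: "inj_on c C"
      show "rainbow_copy_containing (cycle_graph l) (add_edges G (insert {r, w} A)) (joint col c) {r, w}"
      proof (cases "c {r, w} = col {r, s}")
        case True
        have "{r, s} \<notin> pedges R" using R(6) pedges_subset by blast
        then have "c {r, w} \<notin> col ` pedges R"
          using True col R(5) rs(1) by (auto simp: inj_on_def)
        then show ?thesis using rainbow_E[of A R col c] AC col R rs by simp
      next
        case False
        obtain ps where ps: "length ps = l - 1" "distinct ps" "hd ps = s" "last ps = w" "set ps \<subseteq> insert s Z"
          "pedges ps \<subseteq> A" "\<And>d. d \<in> pedges ps \<Longrightarrow> c d \<noteq> col {r, s}"
          by (rule Z_path[OF AC c, of s w "col {r, s}"]) (use ZZ rs(5-7) that in blast)+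
        then have "r \<notin> set ps" using rs by auto
        then show ?thesis using rainbow_mixed[of A r ps c col] AC rs c ps False by auto
      qed
    qed
    then show ?thesis using add rs by blast
  qed
  have earZ: "{base j + r, z} \<in> A" if j: "j < t" and "r \<le> l - 2" "z \<in> Z" for j r z
  proof -
    \<comment> \<open>Induction along the ear from its second vertex: \<open>right\<close> at
      \<open>Suc r\<close> runs away from \<open>base j + r\<close>, which is already joined to
      \<open>Z\<close>.\<close>
    have ge1: "1 \<le> r \<Longrightarrow> r \<le> l - 2 \<Longrightarrow> z \<in> Z \<Longrightarrow> {base j + r, z} \<in> A" for r z
    proof (induction r arbitrary: z rule: dec_induct)
      case base
      then show ?case using ear1 j by simp
    next
      case (step r)
      have "base j + r \<notin> set (right j (Suc r) z)"
        using m_le_base[of j] m ZV[OF step.prems(2)] step.prems(1) l4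
        by (auto simp: right_def simp del: upt_Suc)
      moreover have "{base j + Suc r, base j + r} \<in> E"
        using ear_edge(3)[OF j, of r] step.prems(1) by (simp add: insert_commute)
      ultimately show ?case
        using spread[of "base j + Suc r" "base j + r" z "right j (Suc r) z"] step
          right[OF j, of "Suc r" z] earZC[OF j, of "Suc r" z] earV[OF j, of r] earV[OF j, of "Suc r"]
        by simp
    qed
    show ?thesis
    proof (cases "r = 0")
      case True
      \<comment> \<open>The first ear vertex comes last; its neighbor \<open>base j + 1\<close> is
        joined to \<open>Z\<close>, and \<open>left\<close> runs away from that neighbor.\<close>
      have "base j + 1 \<notin> set (left j 0 z)"
        using m_le_base[of j] m ZV[OF that(3)] l4 by (auto simp: left_def)
      then show ?thesis
        using spread[of "base j" "base j + 1" z "left j 0 z"] True that ge1[of 1] l4 ear_edge(3)[OF j, of 0]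
          left[OF j, of 0 z] earZC[OF j, of 0 z] earV[OF j, of 0] earV[OF j, of 1]
        by simp
    qed (use ge1 that in auto)
  qed
  have outer: "{v, z} \<in> A" if "v \<in> V" "m \<le> v" "z \<in> Z" for v z
    using ear_vertex[of v] that earZ by (metis V_def lessThan_iff)
  have core: "{a, v} \<in> A" if "a < 2 * l" "{a, v} \<in> C" for a v
  proof -
    have v: "v \<in> V" "m \<le> v" using that core_edge[of a v] by (auto simp: C_iff not_le dest: leI)
    have aZ: "a \<notin> Z" "v \<notin> Z" using that(1) v by (auto simp: Z_def)
    have "addable l G col A {a, v}"
      unfolding addable_def
    proof (intro allI impI)
      fix c :: "nat set \<Rightarrow> 'c" assume c: "inj_on c C"
      have Z2: "2 * l \<in> Z" "Suc (2 * l) \<in> Z" using m l4 by (auto simp: Z_def)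
      have aE: "{a, z} \<in> E" if "z \<in> Z" for z
        using core_edge[of a z] \<open>a < 2 * l\<close> that by (auto simp: Z_def)
      \<comment> \<open>Two candidates for \<open>w\<close> suffice: their edges to \<open>a\<close>
        have different colors, so \<open>c {a, v}\<close> differs from one of them.\<close>
      have "col {a, 2 * l} \<noteq> col {a, Suc (2 * l)}"
        using inj_onD[OF col _ aE aE, OF _ Z2] \<open>a < 2 * l\<close> by (auto simp: doubleton_eq_iff)
      then obtain w where w: "w \<in> Z" "c {a, v} \<noteq> col {a, w}"
        using Z2 by metis
      obtain ps where ps: "length ps = l - 1" "distinct ps" "hd ps = v" "last ps = w" "set ps \<subseteq> insert v Z"
        "pedges ps \<subseteq> A" "\<And>d. d \<in> pedges ps \<Longrightarrow> c d \<noteq> col {a, w}"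
        by (rule Z_path[OF AC c, of v w "col {a, w}"]) (use ZZ aZ(2) outer[OF v] w(1) that in blast)+
      have ne: "ps \<noteq> []" using ps(1) l4 by auto
      have "a \<notin> set ps" using ps(5) aZ(1) that v m by auto
      then show "rainbow_copy_containing (cycle_graph l) (add_edges G (insert {a, v} A)) (joint col c) {a, v}"
        using rainbow_mixed[of A a "rev ps" c col] AC that c ps w aE[OF w(1)] ne
        by (simp add: hd_rev last_rev)
    qed
    then show ?thesis using add that by blast
  qed
  have ears: "{u, v} \<in> A" if "{u, v} \<in> C" "m \<le> u" "m \<le> v" for u v
  proof -
    have uv: "u \<in> V" "v \<in> V" "u \<noteq> v" using that by (auto simp: C_iff)
    \<comment> \<open>The cycle runs through \<open>Z\<close> without any edge of \<open>E\<close>,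
      so injectivity of \<open>c\<close> alone makes it rainbow.\<close>
    have "card Z \<ge> l - 2" using m by (simp add: Z_def)
    then obtain zs where zs: "distinct zs" "set zs \<subseteq> Z" "length zs = l - 2"
      using ex_distinct_list[of Z "l - 2"] by (auto simp: Z_def)
    have "zs \<noteq> []" using zs(3) l4 by auto
    have notZ: "u \<notin> Z" "v \<notin> Z" using that by (auto simp: Z_def)
    have "pedges zs \<subseteq> A" using zs ZZ by (intro pedges_clique) auto
    moreover have "{u, hd zs} \<in> A" "{last zs, v} \<in> A"
      using outer[OF uv(1) that(2), of "hd zs"] outer[OF uv(2) that(3), of "last zs"] zs(2) \<open>zs \<noteq> []\<close>
      by (auto simp: insert_commute subset_iff)
    ultimately have "pedges (u # zs @ [v]) \<subseteq> A"
      using \<open>zs \<noteq> []\<close> by (simp add: pedges_subset_iff successively_append_iff successively_Cons hd_append)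
    moreover have "distinct (u # zs @ [v])" "length (u # zs @ [v]) = l"
      using zs uv(3) notZ l4 by auto
    ultimately have "addable l G col A {u, v}"
      using rainbow_C[of A "u # zs @ [v]"] AC that unfolding addable_def by auto
    then show ?thesis using add that by blast
  qed
  obtain e where e: "e \<in> C" "e \<notin> A" using A by auto
  then have "card e = 2" by (simp add: complement_edges_def nsets_def)
  then obtain x y where xy: "e = {x, y}" by (meson card_2_iff)
  have comm: "{y, x} = {x, y}" by auto
  have C: "{x, y} \<in> C" "{y, x} \<in> C" "{x, y} \<notin> A" "{y, x} \<notin> A" using e xy comm by auto
  consider "x < 2 * l" | "y < 2 * l" | "x \<in> Z" "y \<in> Z" | "x \<in> Z" "m \<le> y" | "m \<le> x" "y \<in> Z" | "m \<le> x" "m \<le> y"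
    by (force simp: Z_def)
  then show False
    by cases (use C core ZZ outer ears in \<open>auto simp: C_iff\<close>)
qed

end

section \<open>Both bounds combined\<close>

theorem theorem1p5:
  fixes l n :: nat and K :: "'c set"
  assumes "l \<ge> 4" and "n \<ge> 10 * l" and "infinite K"
  shows "real n + real n / (6 * real l) \<le> real (rwsat K n (cycle_graph l)) \<and>
         real (rwsat K n (cycle_graph l))
           \<le> (real n - 4 * real l) / (real l - 1) * real l + real ((6 * l) choose 2)"
proof -
  define P where "P k \<longleftrightarrow> (\<exists>(F :: nat ugraph) col.
        simple_graph F \<and> verts F = {..<n} \<and> col ` edges F \<subseteq> K \<and>
        weakly_rainbow_saturated K (cycle_graph l) F col \<and> card (edges F) = k)" for k
  have rwsat: "rwsat K n (cycle_graph l) = (LEAST k. P k)"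
    by (simp add: rwsat_def P_def)
  \<comment> \<open>The largest number of ears that leaves at least \<open>4 * l\<close> core
    vertices; the remainder is below \<open>l - 1\<close>, whence
    \<open>m \<le> 6 * l\<close>.\<close>
  define t where "t = (n - 4 * l) div (l - 1)"
  define m where "m = n - t * (l - 1)"
  have t: "t * (l - 1) \<le> n - 4 * l" by (simp add: t_def)
  then have m: "4 * l \<le> m" and n: "n = m + t * (l - 1)" using assms by (auto simp: m_def)
  have "(n - 4 * l) mod (l - 1) < l - 1" using assms by simp
  then have "n - 4 * l - t * (l - 1) < l - 1"
    unfolding t_def by (simp add: minus_div_mult_eq_mod)
  then have "m \<le> 6 * l" using assms(2) by (simp add: m_def)
  then have choose: "m choose 2 \<le> (6 * l) choose 2" by (rule binomial_right_mono)
  interpret ear_graph l m t using assms(1) m by unfold_locales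
  obtain col where col: "inj_on col E" "col ` E \<subseteq> K"
    using ex_inj_on_infinite[OF finite_E assms(3)] .
  have "weakly_rainbow_saturated K (cycle_graph l) G col"
    using ex_addable[OF col(1)] finite_complement_edges[OF simple]
    by (intro weakly_rainbow_saturatedI) auto
  then have "P (card E)"
    unfolding P_def using simple col(2) n by (intro exI[of _ G] exI[of _ col]) (auto simp: G_def V_def base_def)
  have "real (card E) \<le> real t * real l + real (m choose 2)"
    using card_E by (simp flip: of_nat_mult of_nat_add)
  also have "\<dots> \<le> (real n - 4 * real l) / (real l - 1) * real l + real ((6 * l) choose 2)"
  proof (intro add_mono mult_right_mono)
    have "real (t * (l - 1)) \<le> real (n - 4 * l)" using t by (rule of_nat_mono)
    then have "real t * (real l - 1) \<le> real n - 4 * real l"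
      using assms by (simp add: of_nat_diff)
    then show "real t \<le> (real n - 4 * real l) / (real l - 1)"
      using assms(1) by (simp add: pos_le_divide_eq)
  qed (use choose in auto)
  finally have upper: "real (card E) \<le> (real n - 4 * real l) / (real l - 1) * real l + real ((6 * l) choose 2)" .
  \<comment> \<open>The lower bound is shown for every admissible number of edges, hence for the
    least one; \<open>n \<ge> 10 * l\<close> provides \<open>2 * l < n\<close>.\<close>
  have "real n + real n / (6 * real l) \<le> real k" if Pk: "P k" for k
  proof -
    obtain F :: "nat ugraph" and col where F: "simple_graph F" "verts F = {..<n}" "col ` edges F \<subseteq> K"
        "weakly_rainbow_saturated K (cycle_graph l) F col" "card (edges F) = k"
      using Pk unfolding P_def by blast
    then interpret F: saturated K l F col
      using assms by unfold_locales auto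
    show ?thesis using F.card_edges_ge F(2,5) by simp
  qed
  moreover have "P (LEAST k. P k)" "(LEAST k. P k) \<le> card E"
    using \<open>P (card E)\<close> by (rule LeastI, rule Least_le)
  ultimately show ?thesis
    unfolding rwsat using upper by (meson of_nat_mono order_trans)
qed

end
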